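(* Let $N\ge 2$, let $\mathbb{D}_N$ act faithfully on the Riemann sphere $\overline{\mathbb{C}}$ (in the standard form described in the context), and let $\Gamma\subset\overline{\mathbb{C}}$ be a single $\mathbb{D}_N$-orbit. Let $V_{\psi_j}$ be the two-dimensional irreducible projective representation of $\mathbb{D}_N$ described in the context. Put $$F_0=\frac{X^N-Y^N}{2},\qquad F_1=\frac{X^N+Y^N}{2},\qquad F_2=XY,\qquad \lambda=\frac{X}{Y},\qquad (\nu_0,\nu_1,\nu_2)=(2,2,N),$$ and let $(c_1,c_2)\in\mathbb{C}^2\setminus\{(0,0)\}$ (representing a point of $\mathbb{C}P^1$) be such that $F=c_1F_1^2+c_2F_2^N$ vanishes on $\Gamma$. Then, for any $k\in\{0,1,2\}$ with $\Gamma_k\neq\Gamma$, $$\overline{\mathfrak{sl}(V_{\psi_j})}^{\mathbb{D}_N}_{\Gamma}=\left(e_0\oplus e_+\oplus e_-\right)\otimes\mathbb{C}\left[\frac{F_k^{\nu_k}}{F}\right],$$ i.e. this Lie algebra is a free module over the ring $\mathbb{C}[F_k^{\nu_k}/F]$ with basis $e_0,e_+,e_-$, and $$[e_0,e_\pm]=\pm 2e_\pm,\qquad [e_+,e_-]=\left(\prod_{i=0}^2\frac{F_i^{\nu_i}}{F}\right)e_0 ,$$ where a set of module generators realising this is given by $$e_0=\frac{1}{F}\begin{pmatrix} c_1F_0F_1 & F_2^N\left(c_2\lambda^j+\frac{c_1}{2}(\lambda^j+\lambda^{j-N})\right)\\ F_2^N\left(c_2\lambda^{-j}+\frac{c_1}{2}(\lambda^{-j}+\lambda^{N-j})\right)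 & -c_1F_0F_1\end{pmatrix},$$ $$e_+=\frac{F_0F_1F_2^N}{2F^2}\begin{pmatrix}1&-\lambda^j\\ \lambda^{-j}&-1\end{pmatrix},$$ $$e_-=\frac{F_0F_1F_2^N}{2F^2}\begin{pmatrix} c_1+c_2+c_1c_2\frac{F_0^2}{F} & \left(c_2(c_1+c_2)\frac{F_2^N}{F}+c_1\lambda^{-N}\right)\lambda^{j}\\ -\left(c_2(c_1+c_2)\frac{F_2^N}{F}+c_1\lambda^N\right)\lambda^{-j} & -c_1-c_2-c_1c_2\frac{F_0^2}{F}\end{pmatrix}.$$
   Context: The Riemann sphere $\overline{\mathbb{C}}$ is identified with $\mathbb{C}P^1$ via $\lambda=X/Y$; a homogeneous polynomial (form) in $X,Y$ has a well-defined zero set on $\overline{\mathbb{C}}$, and a quotient of two forms of equal degree is a meromorphic function of $\lambda$. $\mathcal{M}(\overline{\mathbb{C}})$ is the field of meromorphic (i.e. rational) functions on $\overline{\mathbb{C}}$. Dihedral group: $\mathbb{D}_n=\langle r,s\mid r^n=s^2=(rs)^2=1\rangle$, of order $2n$. A Schur covering group of $\mathbb{D}_N$ is $\mathbb{D}_N^\flat=\mathbb{D}_M$, where $M=N$ if $N$ is odd and $M=2N$ if $N$ is even; projective representations of $\mathbb{D}_N$ are given by linear representations of $\mathbb{D}_N^\flat$. Let $\omega=e^{2\pi i/M}$. For $1\le j<M/2$, $V_{\psi_j}=\mathbb{C}^2$ is the irreducible $\mathbb{D}_M$-module with character $\psi_j(r^\ell)=\omega^{j\ell}+\omega^{-j\ell}$,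 $\psi_j(sr^\ell)=0$, realised by the matrices $$\tau_r=\begin{pmatrix}\omega^{j}&0\\0&\omega^{-j}\end{pmatrix},\qquad \tau_s=\begin{pmatrix}0&1\\1&0\end{pmatrix}.$$ The action on $(X,Y)$ is by the matrices $\sigma_r=\mathrm{diag}(\omega,\omega^{-1})$ and $\sigma_s=\begin{pmatrix}0&1\\1&0\end{pmatrix}$ (character $\psi_1$); the induced action on $\overline{\mathbb{C}}$ is by the Möbius transformations $r:\lambda\mapsto\omega^2\lambda$ and $s:\lambda\mapsto 1/\lambda$, which is a faithful action of $\mathbb{D}_N$. The exceptional orbits are $\Gamma_0=\{\lambda^N=1\}$, $\Gamma_1=\{\lambda^N=-1\}$, $\Gamma_2=\{0,\infty\}$; $\Gamma_i$ is the zero set of $F_i$. The group acts on $\mathfrak{sl}(V_{\psi_j})\otimes\mathcal{M}(\overline{\mathbb{C}})$ by $(g\cdot f)(\lambda)=\tau_g\, f(g^{-1}\lambda)\,\tau_g^{-1}$. The Automorphic Lie Algebra $\overline{\mathfrak{sl}(V_{\psi_j})}^{\mathbb{D}_N}_{\Gamma}$ is the Lie algebra, with pointwise commutator bracket, of all $f\in\mathfrak{sl}(V_{\psi_j})\otimes\mathcal{M}(\overline{\mathbb{C}})$ that are invariant under this action and analytic on $\overline{\mathbb{C}}\setminus\Gamma$. *)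

theory Defs
  imports
    "HOL-Analysis.Analysis"
    "HOL-Algebra.Group_Action"
    "HOL-Computational_Algebra.Polynomial_Factorial"
    "HOL-Computational_Algebra.Field_as_Ring"
begin

section \<open>Dihedral groups and their two-dimensional representations\<close>

text \<open>The pair \<open>(l, b)\<close> stands for \<open>r\<^sup>l s\<^sup>b\<close>; the multiplication is forced by \<open>s r\<^sup>m = r\<^sup>-\<^sup>m s\<close>.\<close>

definition dihedral :: "nat \<Rightarrow> (int \<times> bool) monoid" where
  "dihedral n =
    \<lparr> carrier = {0..<int n} \<times> UNIV,
      mult = (\<lambda>(l, a) (m, b). ((if a then l - m else l + m) mod int n, a \<noteq> b)),
      one = (0, False) \<rparr>"

text \<open>The order \<open>M\<close> of the rotation in the Schur covering group \<open>dihedral M\<close> of \<open>dihedral N\<close>.\<close>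

definition cover_index :: "nat \<Rightarrow> nat" where
  "cover_index N = (if odd N then N else 2 * N)"

definition omega :: "nat \<Rightarrow> complex" where
  "omega M = exp (2 * of_real pi * \<i> / of_nat M)"

definition mat22 :: "'a::zero \<Rightarrow> 'a \<Rightarrow> 'a \<Rightarrow> 'a \<Rightarrow> 'a^2^2" where
  "mat22 a b c d = vector [vector [a, b], vector [c, d]]"

text \<open>The matrices \<open>\<tau>\<^sub>g\<close> of the representation with character \<open>\<psi>\<^sub>j\<close>; the matrices \<open>\<sigma>\<^sub>g\<close> acting on
  \<open>(X, Y)\<close> are the case \<open>j = 1\<close>.\<close>

definition psi_rep :: "nat \<Rightarrow> nat \<Rightarrow> int \<times> bool \<Rightarrow> complex^2^2" where
  "psi_rep M j = (\<lambda>(l, b).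
     mat22 (omega M powi (int j * l)) 0 0 (omega M powi - (int j * l)) **
     (if b then mat22 0 1 1 0 else mat 1))"

section \<open>The Riemann sphere\<close>

text \<open>\<open>None\<close> is the point at infinity. The point with homogeneous coordinates \<open>(X, Y)\<close> is \<open>X/Y\<close>.\<close>

type_synonym sphere = "complex option"

definition point_of :: "complex^2 \<Rightarrow> sphere" where
  "point_of v = (if v $ 2 = 0 then None else Some (v $ 1 / v $ 2))"

definition coords_of :: "sphere \<Rightarrow> complex^2" where
  "coords_of p = (case p of None \<Rightarrow> vector [1, 0] | Some z \<Rightarrow> vector [z, 1])"

text \<open>\<open>r: \<lambda> \<mapsto> \<omega>\<^sup>2\<lambda>\<close>, \<open>s: \<lambda> \<mapsto> 1/\<lambda>\<close>, induced by \<open>\<sigma>\<close>. Since \<open>\<omega>\<^sup>2\<close> has order \<open>N\<close> for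
  \<open>M = cover_index N\<close>, this is an action of \<open>dihedral N\<close>, although \<open>\<sigma>\<close> itself is a
  representation of \<open>dihedral M\<close> only.\<close>

definition sphere_action :: "nat \<Rightarrow> int \<times> bool \<Rightarrow> sphere \<Rightarrow> sphere" where
  "sphere_action N g p = point_of (psi_rep (cover_index N) 1 g *v coords_of p)"

definition zero_set :: "(complex \<Rightarrow> complex \<Rightarrow> complex) \<Rightarrow> sphere set" where
  "zero_set \<Phi> = {p. \<Phi> (coords_of p $ 1) (coords_of p $ 2) = 0}"

section \<open>Meromorphic functions on the sphere\<close>

text \<open>The field of meromorphic functions on the sphere is the field of rational functions.\<close>

type_synonym mero = "complex poly fract"

definition const_mero :: "complex \<Rightarrow> mero" where
  "const_mero c = to_fract [:c:]"

definition lam :: mero where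
  "lam = to_fract [:0, 1:]"

text \<open>\<open>mero_comp f h\<close> is \<open>f(h(\<lambda>))\<close>, for nonconstant \<open>h\<close>.\<close>

definition mero_comp :: "mero \<Rightarrow> mero \<Rightarrow> mero" where
  "mero_comp f h = (let (p, q) = quot_of_fract f in
     poly (map_poly const_mero p) h / poly (map_poly const_mero q) h)"

text \<open>As \<open>quot_of_fract\<close> yields coprime polynomials, \<open>mero_eval f z\<close> is the value of \<open>f\<close> at every
  finite point that is not a pole (and \<open>0\<close> at the finite poles).\<close>

definition mero_eval :: "mero \<Rightarrow> complex \<Rightarrow> complex" where
  "mero_eval f z = (let (p, q) = quot_of_fract f in poly p z / poly q z)"

definition mero_analytic_at :: "mero \<Rightarrow> sphere \<Rightarrow> bool" where
  "mero_analytic_at f p = (case p of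
       Some z \<Rightarrow> mero_eval f analytic_on {z}
     | None \<Rightarrow> mero_eval (mero_comp f (1 / lam)) analytic_on {0})"

section \<open>Automorphic Lie algebras\<close>

definition moebius :: "complex^2^2 \<Rightarrow> mero" where
  "moebius A = (const_mero (A$1$1) * lam + const_mero (A$1$2)) /
               (const_mero (A$2$1) * lam + const_mero (A$2$2))"

text \<open>\<open>(g \<cdot> f)(\<lambda>) = \<tau>\<^sub>g f(g\<^sup>-\<^sup>1\<lambda>) \<tau>\<^sub>g\<^sup>-\<^sup>1\<close> for \<open>g\<close> in \<open>dihedral M\<close>.\<close>

definition mero_mat_action :: "nat \<Rightarrow> nat \<Rightarrow> int \<times> bool \<Rightarrow> mero^2^2 \<Rightarrow> mero^2^2" where
  "mero_mat_action M j g f =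
     map_matrix const_mero (psi_rep M j g) **
     map_matrix (\<lambda>h. mero_comp h (moebius (psi_rep M 1 (inv\<^bsub>dihedral M\<^esub> g)))) f **
     map_matrix const_mero (matrix_inv (psi_rep M j g))"

definition automorphic_lie_algebra :: "nat \<Rightarrow> nat \<Rightarrow> sphere set \<Rightarrow> (mero^2^2) set" where
  "automorphic_lie_algebra N j \<Gamma> =
     {f. trace f = 0 \<and>
         (\<forall>g \<in> carrier (dihedral (cover_index N)). mero_mat_action (cover_index N) j g f = f) \<and>
         (\<forall>p \<in> - \<Gamma>. \<forall>a b. mero_analytic_at (f $ a $ b) p)}"

definition bracket :: "mero^2^2 \<Rightarrow> mero^2^2 \<Rightarrow> mero^2^2" where
  "bracket A B = A ** B - B ** A"

definition mscale :: "mero \<Rightarrow> mero^2^2 \<Rightarrow> mero^2^2"  (infixr "*\<^sub>M" 75) where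
  "a *\<^sub>M A = map_matrix (\<lambda>x. a * x) A"

text \<open>The subring \<open>\<complex>[t]\<close> of the field of meromorphic functions.\<close>

definition adjoin :: "mero \<Rightarrow> mero set" where
  "adjoin t = range (\<lambda>p. poly (map_poly const_mero p) t)"

section \<open>The forms and the generators\<close>

text \<open>The forms are polymorphic in the field: over \<open>complex\<close> they define zero sets on the sphere, and
  a quotient of forms of equal degree is, as a function of \<open>\<lambda> = X/Y\<close>, obtained by evaluating both
  forms at \<open>(\<lambda>, 1)\<close> in the field of meromorphic functions.\<close>

definition form :: "nat \<Rightarrow> nat \<Rightarrow> 'a::field \<Rightarrow> 'a \<Rightarrow> 'a" where
  "form N i X Y =
     (if i = 0 then (X ^ N - Y ^ N) / 2 else if i = 1 then (X ^ N + Y ^ N) / 2 else X * Y)"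

definition nu :: "nat \<Rightarrow> nat \<Rightarrow> nat" where
  "nu N i = (if i = 0 then 2 else if i = 1 then 2 else N)"

definition exceptional_orbit :: "nat \<Rightarrow> nat \<Rightarrow> sphere set" where
  "exceptional_orbit N i =
     (if i = 0 then {Some z | z. z ^ N = 1} else if i = 1 then {Some z | z. z ^ N = -1}
      else {Some 0, None})"

definition form_orbit :: "nat \<Rightarrow> 'a::field \<Rightarrow> 'a \<Rightarrow> 'a \<Rightarrow> 'a \<Rightarrow> 'a" where
  "form_orbit N c1 c2 X Y = c1 * form N 1 X Y ^ 2 + c2 * form N 2 X Y ^ N"

abbreviation form_mero :: "nat \<Rightarrow> nat \<Rightarrow> mero" where
  "form_mero N i \<equiv> form N i lam 1"

abbreviation form_orbit_mero :: "nat \<Rightarrow> complex \<Rightarrow> complex \<Rightarrow> mero" where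
  "form_orbit_mero N c1 c2 \<equiv> form_orbit N (const_mero c1) (const_mero c2) lam 1"

definition e_zero :: "nat \<Rightarrow> nat \<Rightarrow> complex \<Rightarrow> complex \<Rightarrow> mero^2^2" where
  "e_zero N j c1 c2 =
    (let F0 = form_mero N 0; F1 = form_mero N 1; F2 = form_mero N 2; F = form_orbit_mero N c1 c2;
         C1 = const_mero c1; C2 = const_mero c2; n = int N; i = int j
     in (1 / F) *\<^sub>M mat22
          (C1 * F0 * F1)
          (F2 ^ N * (C2 * lam powi i + C1 / 2 * (lam powi i + lam powi (i - n))))
          (F2 ^ N * (C2 * lam powi (- i) + C1 / 2 * (lam powi (- i) + lam powi (n - i))))
          (- (C1 * F0 * F1)))"

definition e_plus :: "nat \<Rightarrow> nat \<Rightarrow> complex \<Rightarrow> complex \<Rightarrow> mero^2^2" where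
  "e_plus N j c1 c2 =
    (let F0 = form_mero N 0; F1 = form_mero N 1; F2 = form_mero N 2; F = form_orbit_mero N c1 c2; i = int j
     in (F0 * F1 * F2 ^ N / (2 * F ^ 2)) *\<^sub>M mat22
          1                (- (lam powi i))
          (lam powi (- i)) (- 1))"

definition e_minus :: "nat \<Rightarrow> nat \<Rightarrow> complex \<Rightarrow> complex \<Rightarrow> mero^2^2" where
  "e_minus N j c1 c2 =
    (let F0 = form_mero N 0; F1 = form_mero N 1; F2 = form_mero N 2; F = form_orbit_mero N c1 c2;
         C1 = const_mero c1; C2 = const_mero c2; n = int N; i = int j
     in (F0 * F1 * F2 ^ N / (2 * F ^ 2)) *\<^sub>M mat22
          (C1 + C2 + C1 * C2 * (F0 ^ 2 / F))
          ((C2 * (C1 + C2) * (F2 ^ N / F) + C1 * lam powi (- n)) * lam powi i)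
          (- ((C2 * (C1 + C2) * (F2 ^ N / F) + C1 * lam powi n) * lam powi (- i)))
          (- C1 - C2 - C1 * C2 * (F0 ^ 2 / F)))"

section \<open>Consistency of the definitions\<close>

text \<open>\<open>dihedral n\<close> is a group of order \<open>2n\<close>, \<open>psi_rep M j\<close> is a representation of \<open>dihedral M\<close>,
  \<open>sphere_action N\<close> is a faithful action of \<open>dihedral N\<close>, and the exceptional orbits are the zero sets
  of the three forms.\<close>

lemma group_dihedral: assumes "n > 0" shows "group (dihedral n)"
proof (rule groupI)
  fix x assume "x \<in> carrier (dihedral n)"
  then show "\<exists>y\<in>carrier (dihedral n). y \<otimes>\<^bsub>dihedral n\<^esub> x = \<one>\<^bsub>dihedral n\<^esub>"
    using assms by (cases x, intro bexI[of _ "(if snd x then x else (- fst x mod int n, False))"])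
      (auto simp: dihedral_def mod_simps)
qed (use assms in \<open>auto simp: dihedral_def mod_simps algebra_simps split: if_splits\<close>)

lemma order_dihedral: "order (dihedral n) = 2 * n"
  by (simp add: order_def dihedral_def card_cartesian_product)

lemma psi_rep_eq:
  "psi_rep M j (l, b) =
    (let w = omega M powi (int j * l); v = omega M powi - (int j * l)
     in if b then mat22 0 w v 0 else mat22 w 0 0 v)"
  by (simp add: psi_rep_def mat22_def vec_eq_iff forall_2 matrix_matrix_mult_def sum_2 mat_def Let_def)

lemma omega_nonzero: "omega M \<noteq> 0" by (simp add: omega_def)

lemma omega_powi_eq_1_iff: assumes "M > 0" shows "omega M powi m = 1 \<longleftrightarrow> int M dvd m"
proof -
  have "omega M powi m = exp (2 * of_real pi * \<i> * (of_int m / of_nat M))"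
    unfolding omega_def exp_power_int by (simp add: mult_ac)
  also have "\<dots> = 1 \<longleftrightarrow> (\<exists>k::int. of_int m / real M = of_int k)"
  proof -
    have eq: "2 * of_real pi * \<i> * (of_int m / of_nat M) =
        (\<i> * of_real (2 * pi * (of_int m / real M)) :: complex)"
      by (simp add: mult_ac)
    have "2 * pi * (of_int m / real M) = of_int (2 * k) * pi \<longleftrightarrow> of_int m / real M = of_int k" for k
    proof -
      have "of_int (2 * k) * pi = 2 * pi * of_int k" by simp
      then show ?thesis by (simp only: mult_cancel_left) simp
    qed
    then show ?thesis
      unfolding exp_eq_1 eq Re_i_times Im_i_times by (simp only: Re_complex_of_real Im_complex_of_real) simp
  qed
  also have "\<dots> \<longleftrightarrow> int M dvd m"
  proof -
    have "(of_int m / real M = of_int k) \<longleftrightarrow> m = int M * k" for k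
    proof -
      have "of_int m / real M = of_int k \<longleftrightarrow> real_of_int m = of_int (int M * k)"
        using assms by (simp add: divide_eq_eq mult.commute)
      then show ?thesis by (simp only: of_int_eq_iff)
    qed
    then show ?thesis by (auto simp: dvd_def)
  qed
  finally show ?thesis .
qed

lemma omega_powi_cong: assumes "M > 0" "int M dvd a - b" shows "omega M powi a = omega M powi b"
  using omega_powi_eq_1_iff[OF assms(1), of "a-b"] assms omega_nonzero[of M]
  by (simp add: power_int_diff)

lemma psi_rep_mult:
  assumes "M > 0"
  shows "psi_rep M j (g \<otimes>\<^bsub>dihedral M\<^esub> h) = psi_rep M j g ** psi_rep M j h"
proof -
  obtain l a m b where [simp]: "g = (l, a)" "h = (m, b)" by (cases g, cases h)
  have *: "omega M powi (int j * (x mod int M)) = omega M powi (int j * x)" for x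
  proof (rule omega_powi_cong[OF assms])
    have "int M dvd x mod int M - x" by (simp flip: mod_eq_dvd_iff)
    then show "int M dvd int j * (x mod int M) - int j * x"
      by (simp flip: right_diff_distrib)
  qed
  have pow: "omega M powi (int j * (l + m)) = omega M powi (int j * l) * omega M powi (int j * m)"
    "omega M powi (int j * (l - m)) = omega M powi (int j * l) * inverse (omega M powi (int j * m))"
    for l m
    using omega_nonzero[of M]
    by (simp_all add: ring_distribs power_int_add power_int_diff divide_inverse)
  show ?thesis
    by (auto simp: dihedral_def psi_rep_eq * pow Let_def mat22_def vec_eq_iff forall_2
        matrix_matrix_mult_def sum_2 power_int_minus)
qed

lemma sphere_action_eq:
  "sphere_action N (l, b) p =
    (let u = omega (cover_index N) powi (2 * l) in
     case p of None \<Rightarrow> if b then Some 0 else None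
     | Some z \<Rightarrow> if b then if z = 0 then None else Some (u / z) else Some (u * z))"
proof -
  define w where "w = omega (cover_index N) powi l"
  have nz: "w \<noteq> 0" and w2: "omega (cover_index N) powi (2 * l) = w * w"
    unfolding w_def mult_2 using omega_nonzero by (simp, metis power_int_add)
  have \<sigma>: "psi_rep (cover_index N) 1 (l, b) =
      (if b then mat22 0 w (inverse w) 0 else mat22 w 0 0 (inverse w))"
    by (simp add: psi_rep_eq w_def power_int_minus Let_def)
  show ?thesis
    unfolding sphere_action_def \<sigma> w2
    using nz by (cases p; cases b)
      (simp_all add: mat22_def point_of_def coords_of_def matrix_vector_mult_def sum_2 divide_inverse)
qed

lemma cover2: "N > 0 \<Longrightarrow> int (cover_index N) dvd 2 * x \<longleftrightarrow> int N dvd x"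
  by (auto simp: cover_index_def coprime_dvd_mult_right_iff)

lemma omega_mod: assumes "N > 0"
  shows "omega (cover_index N) powi (2 * (x mod int N)) = omega (cover_index N) powi (2 * x)"
  proof (rule omega_powi_cong)
  have "int N dvd x mod int N - x" by (simp flip: mod_eq_dvd_iff)
  then show "int (cover_index N) dvd 2 * (x mod int N) - 2 * x"
    unfolding cover2[OF assms] right_diff_distrib[symmetric] .
qed (use assms in \<open>simp add: cover_index_def\<close>)

lemma faithful_sphere_action:
  assumes "N > 1"
  shows "faithful_action (dihedral N) UNIV (sphere_action N)"
proof -
  interpret group "dihedral N" using assms by (intro group_dihedral) auto
  have N: "N > 0" using assms by simp
  have mult: "sphere_action N (g \<otimes>\<^bsub>dihedral N\<^esub> h) = sphere_action N g \<circ> sphere_action N h" for g h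
  proof -
    obtain l a m b where [simp]: "g = (l, a)" "h = (m, b)" by (cases g, cases h)
    let ?w = "\<lambda>x. omega (cover_index N) powi (2 * x)"
    have nz: "?w x \<noteq> 0" for x using omega_nonzero by simp
    have w: "?w (x + y) = ?w x * ?w y" "?w (x - y) = ?w x / ?w y" for x y
      unfolding ring_distribs using omega_nonzero by (metis power_int_add, metis power_int_diff)
    have "sphere_action N (g \<otimes>\<^bsub>dihedral N\<^esub> h) p = (sphere_action N g \<circ> sphere_action N h) p" for p
      using nz by (cases p; cases a; cases b)
        (simp_all add: dihedral_def sphere_action_eq omega_mod[OF N] w w[unfolded ring_distribs] Let_def
          del: power_int_eq_0_iff)
    then show ?thesis by blast
  qed
  have one: "sphere_action N \<one>\<^bsub>dihedral N\<^esub> = id"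
    by (intro ext) (auto simp: dihedral_def sphere_action_eq split: option.splits)
  have bij: "bij (sphere_action N g)" if "g \<in> carrier (dihedral N)" for g
    by (intro o_bij[of "sphere_action N (inv\<^bsub>dihedral N\<^esub> g)"])
      (use that in \<open>simp_all add: one flip: mult\<close>)
  interpret B: group "BijGroup (UNIV :: sphere set)" by (rule group_BijGroup)
  show ?thesis
  proof unfold_locales
    show "sphere_action N \<in> hom (dihedral N) (BijGroup UNIV)"
      by (intro homI) (simp_all add: BijGroup_def Bij_def bij mult restrict_def compose_def o_def)
    show "inj_on (sphere_action N) (carrier (dihedral N))"
    proof (rule inj_onI)
      fix g h assume g: "g \<in> carrier (dihedral N)" and h: "h \<in> carrier (dihedral N)"
        and eq: "sphere_action N g = sphere_action N h"
      obtain l a m b where [simp]: "g = (l, a)" "h = (m, b)" by (cases g, cases h)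
      have ab: "a = b"
        using fun_cong[OF eq, of None] by (simp add: sphere_action_eq Let_def split: if_splits)
      from fun_cong[OF eq, of "Some 1"] ab
      have "omega (cover_index N) powi (2 * l) = omega (cover_index N) powi (2 * m)"
        by (auto simp: sphere_action_eq Let_def split: if_splits)
      then have "omega (cover_index N) powi (2 * l - 2 * m) = 1"
        using omega_nonzero[of "cover_index N"] by (simp add: power_int_diff)
      moreover have "cover_index N > 0"
        using N by (simp add: cover_index_def)
      ultimately have "int N dvd l - m"
        using omega_powi_eq_1_iff cover2[OF N] right_diff_distrib[of 2 l m] by metis
      then have "l mod int N = m mod int N"
        by (simp only: mod_eq_dvd_iff)
      then have "l = m" using g h by (simp add: dihedral_def)
      then show "g = h" using ab by simp
    qed
  qed
qed

lemma zero_set_form: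
  assumes "N > 0"
  shows "zero_set (form N i) = exceptional_orbit N i"
proof -
  have "p \<in> zero_set (form N i) \<longleftrightarrow> p \<in> exceptional_orbit N i" for p
    using assms by (cases p)
      (auto simp: zero_set_def form_def exceptional_orbit_def coords_of_def add_eq_0_iff2 power_0_left)
  then show ?thesis by blast
qed

end

theory Submission
  imports Defs "HOL-Computational_Algebra.Fundamental_Theorem_Algebra"
begin

text \<open>
  A function is analytic off \<open>\<Gamma>\<close> iff it is a quotient \<open>P/F\<^sup>m\<close> of forms of equal degree; call the ring
  of these functions \<open>S\<close>. The invariants in \<open>S\<close> form \<open>\<complex>[F\<^sub>k\<^sup>\<nu>/F]\<close>. An invariant matrix is determined by
  three functions \<open>\<alpha>\<close>, \<open>\<beta>\<close>, \<open>\<gamma>\<close> of \<open>\<lambda>\<^sup>N\<close>, and its coefficients with respect to \<open>e\<^sub>0\<close>, \<open>e\<^sub>\<plusminus>\<close>, read off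
  from the trace form, are invariant. Those of \<open>e\<^sub>+\<close> and \<open>e\<^sub>-\<close> have the denominator \<open>F\<^sub>0F\<^sub>1\<close>, but their
  numerators change sign under \<open>\<lambda> \<mapsto> 1/\<lambda>\<close>, hence vanish wherever \<open>\<lambda>\<^sup>2\<^sup>N = 1\<close>, so the coefficients lie
  in \<open>S\<close>.
\<close>

section \<open>Substitution in rational functions\<close>

text \<open>Because F_0^2 = F_1^2 - F_2^N, each power of F_k in question lies, like F, in the pencil
  spanned by F_1^2 and F_2^N. The three choices of \<open>k\<close> thus become one situation: a
  second member of the pencil, with coefficients \<open>(d1, d2)\<close> not proportional to
  \<open>(c1, c2)\<close>. That \<Gamma>_k differs from \<Gamma> is exactly what gives this
  independence. Forms are handled at Y = 1, so a form of degree 2Nm is a polynomial of degree at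
  most 2Nm, and regularity at infinity becomes a degree bound. The obstacle is at 0 and infinity.
  The matrix entries are \<lambda>^j \<beta> and \<lambda>^(-j) \<gamma>, while the coefficients
  involve \<beta> and \<gamma> themselves, and the coefficient of e_+ also has F_2^N in its
  denominator. Invariance under rotations, together with 0 < j < N, yields more than expected: not
  only \<beta> and \<gamma> but also \<lambda>^N \<beta> and \<lambda>^(-N) \<gamma> are regular off
  \<Gamma>, and this absorbs the extra denominator.\<close>

lemma const_mero_simps [simp]:
  "const_mero 0 = 0" "const_mero 1 = 1"
  "const_mero (a + b) = const_mero a + const_mero b"
  "const_mero (a - b) = const_mero a - const_mero b"
  "const_mero (- a) = - const_mero a"
  "const_mero (a * b) = const_mero a * const_mero b"
  by (simp_all add: const_mero_def flip: to_fract_add to_fract_diff to_fract_uminus to_fract_mult)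
     (simp add: one_pCons flip: to_fract_1)

lemma const_mero_eq_iff [simp]: "const_mero a = const_mero b \<longleftrightarrow> a = b"
  by (simp add: const_mero_def)

lemma const_mero_eq_0_iff [simp]: "const_mero a = 0 \<longleftrightarrow> a = 0"
  by (simp add: const_mero_def)

lemma const_mero_inverse [simp]: "const_mero (inverse a) = inverse (const_mero a)"
proof (cases "a = 0")
  case False
  then have "const_mero a * const_mero (inverse a) = 1"
    by (simp flip: const_mero_simps(6))
  then show ?thesis
    by (simp add: inverse_unique)
qed auto

lemma const_mero_divide [simp]: "const_mero (a / b) = const_mero a / const_mero b"
  by (simp add: divide_inverse)

lemma const_mero_power [simp]: "const_mero (a ^ n) = const_mero a ^ n"
  by (induction n) auto

lemma const_mero_numeral [simp]: "const_mero (numeral n) = numeral n"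
proof -
  have "const_mero (of_nat k) = of_nat k" for k
    by (induction k) auto
  from this[of "numeral n"] show ?thesis
    by simp
qed

lemma numeral_mero_nonzero [simp]: "(numeral n :: mero) \<noteq> 0"
proof -
  have "const_mero (numeral n) \<noteq> 0"
    by (simp only: const_mero_eq_0_iff) simp
  then show ?thesis by simp
qed

lemma lam_nonzero [simp]: "lam \<noteq> 0"
  by (simp add: lam_def)

lemma to_fract_power: "to_fract (p ^ n) = to_fract p ^ n"
  by (induction n) auto

definition mero_poly :: "complex poly \<Rightarrow> mero \<Rightarrow> mero" where
  "mero_poly p h = poly (map_poly const_mero p) h"

lemma mero_poly_pCons [simp]: "mero_poly (pCons a p) h = const_mero a + h * mero_poly p h"
  by (simp add: mero_poly_def map_poly_pCons)

lemma mero_poly_0 [simp]: "mero_poly 0 h = 0"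
  by (simp add: mero_poly_def)

lemma mero_poly_1 [simp]: "mero_poly 1 h = 1"
  by (simp add: one_pCons)

lemma mero_poly_add [simp]: "mero_poly (p + q) h = mero_poly p h + mero_poly q h"
proof -
  have "map_poly const_mero (p + q) = map_poly const_mero p + map_poly const_mero q"
    by (intro poly_eqI) (simp add: coeff_map_poly)
  then show ?thesis by (simp add: mero_poly_def)
qed

lemma mero_poly_smult [simp]: "mero_poly (smult c p) h = const_mero c * mero_poly p h"
proof -
  have "map_poly const_mero (smult c p) = smult (const_mero c) (map_poly const_mero p)"
    by (intro poly_eqI) (simp add: coeff_map_poly)
  then show ?thesis by (simp add: mero_poly_def)
qed

lemma mero_poly_minus [simp]: "mero_poly (- p) h = - mero_poly p h"
  using mero_poly_smult[of "-1" p h] by simp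

lemma mero_poly_diff [simp]: "mero_poly (p - q) h = mero_poly p h - mero_poly q h"
  using mero_poly_add[of p "- q" h] by simp

lemma mero_poly_mult [simp]: "mero_poly (p * q) h = mero_poly p h * mero_poly q h"
  by (induction p) (simp_all add: ring_distribs)

lemma mero_poly_power [simp]: "mero_poly (p ^ n) h = mero_poly p h ^ n"
  by (induction n) simp_all

lemma mero_poly_lam [simp]: "mero_poly p lam = to_fract p"
proof (induction p)
  case (pCons a p)
  have "pCons a p = [:a:] + [:0, 1:] * p" by simp
  then have "to_fract (pCons a p) = to_fract [:a:] + lam * to_fract p"
    unfolding lam_def by (simp only: to_fract_add to_fract_mult)
  then show ?case
    using pCons by (simp add: const_mero_def)
qed simp

lemma to_fract_smult: "to_fract (smult c p) = const_mero c * to_fract p"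
  using mero_poly_smult[of c p lam] by simp

lemma mero_poly_pcompose: "mero_poly (pcompose p q) h = mero_poly p (mero_poly q h)"
  by (induction p) (simp_all add: pcompose_pCons)

text \<open>A zero of a complex polynomial in a larger field is one of its complex zeros.\<close>

lemma mero_poly_nonzero:
  assumes "p \<noteq> 0" "h \<notin> range const_mero"
  shows "mero_poly p h \<noteq> 0"
  using assms(1)
proof (induction p rule: poly_root_order_induct)
  case (no_roots p)
  then have "constant (poly p)"
    using fundamental_theorem_of_algebra by blast
  then have "degree p = 0"
    by (simp add: constant_degree)
  with no_roots show ?case
    by (auto elim!: degree_eq_zeroE)
next
  case (root p x n)
  have "h - const_mero x \<noteq> 0"
    using assms(2) by auto
  with root show ?case by auto
qed auto

lemma quot_of_fract_cases:
  obtains p q where "quot_of_fract h = (p, q)" "q \<noteq> 0" "coprime p q" "h = to_fract p / to_fract q"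
proof (rule that)
  show "quot_of_fract h = (fst (quot_of_fract h), snd (quot_of_fract h))" by simp
  show "h = to_fract (fst (quot_of_fract h)) / to_fract (snd (quot_of_fract h))"
    by (metis Fract_conv_to_fract Fract_quot_of_fract)
qed (simp_all add: coprime_quot_of_fract)

lemma to_fract_divide_eq_iff:
  assumes "q \<noteq> 0" "q' \<noteq> 0"
  shows "to_fract p / to_fract q = to_fract p' / to_fract q' \<longleftrightarrow> p * q' = p' * q"
  using assms by (simp add: frac_eq_eq flip: to_fract_mult)

context
  fixes h :: mero
  assumes h: "h \<notin> range const_mero"
begin

text \<open>\<open>mero_comp\<close> is defined through the reduced fraction, which is not
  compatible with sums and products. Once any representing fraction may be used, substitution is
  visibly a field homomorphism; nonconstancy of \<open>h\<close> keeps the denominators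
  nonzero.\<close>

lemma mero_comp_frac:
  assumes "q \<noteq> 0"
  shows "mero_comp (to_fract p / to_fract q) h = mero_poly p h / mero_poly q h"
proof -
  obtain p' q' where pq: "quot_of_fract (to_fract p / to_fract q) = (p', q')" "q' \<noteq> 0"
    "to_fract p / to_fract q = to_fract p' / to_fract q'"
    by (rule quot_of_fract_cases)
  then have "p' * q = p * q'"
    using assms by (simp add: to_fract_divide_eq_iff)
  then have "mero_poly p' h * mero_poly q h = mero_poly p h * mero_poly q' h"
    by (metis mero_poly_mult)
  then show ?thesis
    using mero_poly_nonzero[OF assms h] mero_poly_nonzero[OF pq(2) h]
    by (simp add: mero_comp_def pq(1) frac_eq_eq flip: mero_poly_def)
qed

lemma mero_comp_to_fract: "mero_comp (to_fract p) h = mero_poly p h"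
  using mero_comp_frac[of 1 p] by simp

lemma mero_comp_const: "mero_comp (const_mero c) h = const_mero c"
  using mero_comp_to_fract[of "[:c:]"] by (simp flip: const_mero_def)

lemma mero_comp_lam: "mero_comp lam h = h"
  by (simp add: lam_def mero_comp_to_fract)

lemma mero_comp_add: "mero_comp (f + g) h = mero_comp f h + mero_comp g h"
proof -
  obtain p q p' q' where f: "f = to_fract p / to_fract q" "q \<noteq> 0"
    and g: "g = to_fract p' / to_fract q'" "q' \<noteq> 0"
    by (metis quot_of_fract_cases)
  have "f + g = to_fract (p * q' + p' * q) / to_fract (q * q')"
    using f g by (simp add: add_frac_eq)
  then have "mero_comp (f + g) h = mero_poly (p * q' + p' * q) h / mero_poly (q * q') h"
    using f g mero_comp_frac[of "q * q'" "p * q' + p' * q"] by auto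
  then show ?thesis
    using f g mero_poly_nonzero[OF _ h, of q] mero_poly_nonzero[OF _ h, of q']
    by (simp add: mero_comp_frac add_frac_eq)
qed

lemma mero_comp_mult: "mero_comp (f * g) h = mero_comp f h * mero_comp g h"
proof -
  obtain p q p' q' where f: "f = to_fract p / to_fract q" "q \<noteq> 0"
    and g: "g = to_fract p' / to_fract q'" "q' \<noteq> 0"
    by (metis quot_of_fract_cases)
  have "f * g = to_fract (p * p') / to_fract (q * q')"
    using f g by simp
  then have "mero_comp (f * g) h = mero_poly (p * p') h / mero_poly (q * q') h"
    using f g mero_comp_frac[of "q * q'" "p * p'"] by auto
  then show ?thesis
    using f g by (simp add: mero_comp_frac)
qed

lemma mero_comp_minus: "mero_comp (- f) h = - mero_comp f h"
  using mero_comp_mult[of "const_mero (- 1)" f]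
  unfolding mero_comp_const by simp

lemma mero_comp_diff: "mero_comp (f - g) h = mero_comp f h - mero_comp g h"
  using mero_comp_add[of f "- g"] by (simp add: mero_comp_minus)

lemma mero_comp_0: "mero_comp 0 h = 0"
  using mero_comp_const[of 0] by simp

lemma mero_comp_1: "mero_comp 1 h = 1"
  using mero_comp_const[of 1] by simp

lemma mero_comp_numeral: "mero_comp (numeral n) h = numeral n"
  using mero_comp_const[of "numeral n"] by simp

lemma mero_comp_inverse: "mero_comp (inverse f) h = inverse (mero_comp f h)"
proof (cases "f = 0")
  case False
  then have "mero_comp f h * mero_comp (inverse f) h = 1"
    by (simp add: mero_comp_1 flip: mero_comp_mult)
  then show ?thesis
    by (simp add: inverse_unique)
qed (simp add: mero_comp_0)

lemma mero_comp_divide: "mero_comp (f / g) h = mero_comp f h / mero_comp g h"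
  by (simp add: divide_inverse mero_comp_mult mero_comp_inverse)

lemma mero_comp_power: "mero_comp (f ^ n) h = mero_comp f h ^ n"
  by (induction n) (simp_all add: mero_comp_1 mero_comp_mult)

lemma mero_comp_powi: "mero_comp (f powi n) h = mero_comp f h powi n"
  by (simp add: power_int_def mero_comp_power mero_comp_inverse)

lemmas mero_comp_hom = mero_comp_const mero_comp_lam mero_comp_add mero_comp_mult mero_comp_minus
  mero_comp_diff mero_comp_0 mero_comp_1 mero_comp_numeral mero_comp_inverse mero_comp_divide
  mero_comp_power mero_comp_powi

end

lemma lam_multiple_nonconst: "c \<noteq> 0 \<Longrightarrow> const_mero c * lam \<notin> range const_mero"
  by (auto simp: const_mero_def lam_def simp flip: to_fract_mult)

lemma lam_inverse_multiple_nonconst: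
  assumes "c \<noteq> 0"
  shows "const_mero c / lam \<notin> range const_mero"
proof
  assume "const_mero c / lam \<in> range const_mero"
  then obtain a where "const_mero c = const_mero a * lam"
    by (auto simp: field_simps)
  then show False
    using assms by (auto simp: const_mero_def lam_def simp flip: to_fract_mult)
qed

section \<open>Reversed polynomials: the change of coordinate to infinity\<close>

lemma poly_as_sum_le:
  fixes p :: "'a::comm_semiring_1 poly"
  assumes "degree p \<le> n"
  shows "poly p x = (\<Sum>i\<le>n. poly.coeff p i * x ^ i)"
  unfolding poly_altdef by (intro sum.mono_neutral_left) (use assms in \<open>auto simp: coeff_eq_0\<close>)

text \<open>The affine part of a form of degree \<open>n\<close> after exchanging X and Y. The
  degree is a parameter because \<open>degree p < n\<close> is meaningful: the form then vanishes at
  infinity.\<close>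

definition rev_poly :: "nat \<Rightarrow> complex poly \<Rightarrow> complex poly" where
  "rev_poly n p = (\<Sum>i\<le>n. monom (poly.coeff p i) (n - i))"

lemma degree_rev_poly: "degree (rev_poly n p) \<le> n"
  unfolding rev_poly_def by (intro degree_sum_le) (auto intro: order_trans[OF degree_monom_le])

lemma poly_rev_poly:
  assumes "degree p \<le> n" "z \<noteq> 0"
  shows "poly (rev_poly n p) z = z ^ n * poly p (inverse z)"
proof -
  have "poly (rev_poly n p) z = (\<Sum>i\<le>n. poly.coeff p i * z ^ (n - i))"
    by (simp add: rev_poly_def poly_sum poly_monom)
  also have "\<dots> = (\<Sum>i\<le>n. z ^ n * (poly.coeff p i * inverse z ^ i))"
    using assms(2) by (intro sum.cong) (auto simp: power_diff field_simps)
  also have "\<dots> = z ^ n * poly p (inverse z)"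
    using assms(1) by (simp add: poly_as_sum_le sum_distrib_left)
  finally show ?thesis .
qed

lemma poly_rev_poly_0: "poly (rev_poly n p) 0 = poly.coeff p n"
proof -
  have "poly (rev_poly n p) 0 = (\<Sum>i\<le>n. if i = n then poly.coeff p n else 0)"
    unfolding rev_poly_def poly_sum poly_monom by (intro sum.cong) (auto simp: power_0_left)
  then show ?thesis by simp
qed

lemma to_fract_monom: "to_fract (monom a n) = const_mero a * lam ^ n"
proof -
  have "monom a n = [:a:] * [:0, 1:] ^ n"
    by (simp add: monom_altdef)
  then show ?thesis
    by (simp only: to_fract_mult to_fract_power const_mero_def lam_def)
qed

lemma mero_poly_inverse_lam:
  assumes "degree p \<le> n"
  shows "mero_poly p (1 / lam) * lam ^ n = to_fract (rev_poly n p)"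
proof -
  have "degree (map_poly const_mero p) \<le> n"
    using assms by (simp add: degree_map_poly)
  then have "mero_poly p (1 / lam) * lam ^ n =
      (\<Sum>i\<le>n. const_mero (poly.coeff p i) * (1 / lam) ^ i * lam ^ n)"
    unfolding mero_poly_def by (simp add: poly_as_sum_le coeff_map_poly sum_distrib_right)
  also have "\<dots> = (\<Sum>i\<le>n. const_mero (poly.coeff p i) * lam ^ (n - i))"
    by (intro sum.cong) (auto simp: power_diff field_simps)
  finally show ?thesis
    by (simp add: rev_poly_def to_fract_monom)
qed

section \<open>Analyticity and divisibility\<close>

text \<open>A zero of the reduced denominator is a genuine pole, but \<open>mero_eval\<close> takes
  the default value 0 there, so analyticity has to be refuted: continuity would make the numerator
  vanish too, against coprimality. Conversely, the reduced denominator divides every other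
  one.\<close>

lemma mero_eval_analytic_iff:
  "mero_eval f analytic_on {z} \<longleftrightarrow> (\<exists>p q. f = to_fract p / to_fract q \<and> poly q z \<noteq> 0)"
proof -
  obtain p q where pq: "quot_of_fract f = (p, q)" "q \<noteq> 0" "coprime p q"
    "f = to_fract p / to_fract q"
    by (rule quot_of_fract_cases)
  have eval: "mero_eval f = (\<lambda>w. poly p w / poly q w)"
    by (simp add: mero_eval_def pq(1) fun_eq_iff)
  have poly: "poly r analytic_on {z}" for r :: "complex poly"
    by (intro holomorphic_on_imp_analytic_at[of _ UNIV] holomorphic_intros) auto
  show ?thesis
  proof
    assume an: "mero_eval f analytic_on {z}"
    have "poly q z \<noteq> 0"
    proof
      assume z: "poly q z = 0"
      have lim: "(\<lambda>w. mero_eval f w * poly q w) \<midarrow>z\<rightarrow> mero_eval f z * poly q z"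
        using analytic_at_imp_isCont[OF an]
        by (intro tendsto_mult) (auto simp: isCont_def intro!: tendsto_poly)
      have "\<forall>\<^sub>F w in at z. poly q w \<noteq> 0"
        using islimpt_finite[OF poly_roots_finite[OF pq(2)], of z]
        by (auto simp: islimpt_iff_eventually)
      then have "\<forall>\<^sub>F w in at z. mero_eval f w * poly q w = poly p w"
        by eventually_elim (simp add: eval)
      then have "poly p \<midarrow>z\<rightarrow> 0"
        using Lim_transform_eventually[OF lim] z by simp
      moreover have "poly p \<midarrow>z\<rightarrow> poly p z"
        by (intro tendsto_poly tendsto_ident_at)
      ultimately have "poly p z = 0"
        using LIM_unique by blast
      then show False
        using z pq(3) by (meson coprime_poly_0)
    qed
    then show "\<exists>p q. f = to_fract p / to_fract q \<and> poly q z \<noteq> 0"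
      using pq(4) by blast
  next
    assume "\<exists>p q. f = to_fract p / to_fract q \<and> poly q z \<noteq> 0"
    then obtain p' q' where pq': "f = to_fract p' / to_fract q'" "poly q' z \<noteq> 0"
      by blast
    moreover have "q' \<noteq> 0"
      using pq'(2) by auto
    ultimately have "p' * q = p * q'"
      using pq to_fract_divide_eq_iff[of q' q p' p] by simp
    then have "q dvd q'"
      using pq(3) by (metis coprime_commute coprime_dvd_mult_right_iff dvd_triv_right)
    then have "poly q z \<noteq> 0"
      using pq'(2) by (auto elim!: dvdE)
    then show "mero_eval f analytic_on {z}"
      unfolding eval by (intro analytic_on_divide poly) auto
  qed
qed

lemma mero_analytic_at_infinity_iff:
  assumes "q \<noteq> 0"
  shows "mero_analytic_at (to_fract p / to_fract q) None \<longleftrightarrow> degree p \<le> degree q"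
proof -
  have nonconst: "1 / lam \<notin> range const_mero"
    using lam_inverse_multiple_nonconst[of 1] by simp
  have comp: "mero_comp (to_fract p / to_fract q) (1 / lam) =
      to_fract (rev_poly n p) / to_fract (rev_poly n q)"
    if "degree p \<le> n" "degree q \<le> n" for n
    using that by (simp add: mero_comp_frac[OF nonconst assms] flip: mero_poly_inverse_lam)
  have rev_nz: "rev_poly n q \<noteq> 0" if "degree q \<le> n" for n
    using mero_poly_nonzero[OF assms nonconst] that
    by (metis to_fract_eq_0_iff lam_nonzero mero_poly_inverse_lam mult_eq_0_iff power_not_zero)
  show ?thesis
  proof
    assume le: "degree p \<le> degree q"
    then show "mero_analytic_at (to_fract p / to_fract q) None"
      using assms comp[OF le] unfolding mero_analytic_at_def option.case mero_eval_analytic_iff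
      by (metis leading_coeff_0_iff order_refl poly_rev_poly_0)
  next
    assume "mero_analytic_at (to_fract p / to_fract q) None"
    then obtain P Q where PQ: "mero_comp (to_fract p / to_fract q) (1 / lam) = to_fract P / to_fract Q"
      and Q: "poly Q 0 \<noteq> 0"
      by (auto simp: mero_analytic_at_def mero_eval_analytic_iff)
    show "degree p \<le> degree q"
    proof (rule ccontr)
      assume gt: "\<not> degree p \<le> degree q"
      \<comment> \<open>Both polynomials are reversed with the same formal degree
        \<open>degree p\<close>. At 0 the left side is the leading coefficient of \<open>p\<close>
        times a nonzero number, whereas the coefficient of \<open>q\<close> on the right lies beyond
        its degree.\<close>
      have "rev_poly (degree p) p * Q = P * rev_poly (degree p) q"
        using PQ Q gt rev_nz[of "degree p"] unfolding comp[OF order_refl less_imp_le[OF gt[unfolded not_le]]]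
        by (subst (asm) to_fract_divide_eq_iff) auto
      then have "poly.coeff p (degree p) * poly Q 0 = poly P 0 * poly.coeff q (degree p)"
        by (metis poly_mult poly_rev_poly_0)
      then show False
        using gt Q by (auto simp: coeff_eq_0)
    qed
  qed
qed

lemma mero_analytic_at_finite_iff:
  "mero_analytic_at f (Some z) \<longleftrightarrow> (\<exists>p q. f = to_fract p / to_fract q \<and> poly q z \<noteq> 0)"
  by (simp add: mero_analytic_at_def mero_eval_analytic_iff)

text \<open>The Nullstellensatz in one variable, with an explicit exponent: splitting off the zeros
  of \<open>q\<close> one by one uses up one factor \<open>p\<close> for each.\<close>

lemma dvd_power_degree_if_roots_subset:
  fixes p q :: "complex poly"
  assumes "q \<noteq> 0" "\<And>z. poly q z = 0 \<Longrightarrow> poly p z = 0"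
  shows "q dvd p ^ degree q"
  using assms
proof (induction "degree q" arbitrary: q)
  case 0
  then show ?case
    by (simp add: is_unit_iff_degree)
next
  case (Suc n)
  then have "\<not> constant (poly q)"
    by (simp add: constant_degree)
  then obtain z where z: "poly q z = 0"
    using fundamental_theorem_of_algebra by blast
  then obtain r where r: "q = [:- z, 1:] * r"
    by (auto simp: poly_eq_0_iff_dvd)
  with Suc have "r \<noteq> 0" by auto
  with r have deg: "degree q = Suc (degree r)"
    by (simp add: degree_mult_eq del: mult_pCons_left)
  have "r dvd p ^ degree r"
    using Suc \<open>r \<noteq> 0\<close> deg r by (intro Suc.hyps) auto
  moreover have "[:- z, 1:] dvd p"
    using Suc(4)[OF z] by (simp add: poly_eq_0_iff_dvd)
  ultimately show ?case
    using r deg by (metis mult_dvd_mono power_Suc)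
qed

text \<open>The degree bound means that \<open>d\<close> has only the zeros in \<open>A\<close>, all
  simple. A nonzero remainder modulo \<open>d\<close> would have at least \<open>degree d\<close>
  zeros.\<close>

lemma dvd_if_roots:
  fixes d q :: "complex poly"
  assumes "d \<noteq> 0" "finite A" "degree d \<le> card A"
    and d: "\<And>z. z \<in> A \<Longrightarrow> poly d z = 0" and q: "\<And>z. z \<in> A \<Longrightarrow> poly q z = 0"
  shows "d dvd q"
proof -
  have "q mod d = 0"
  proof (rule ccontr)
    assume nz: "q mod d \<noteq> 0"
    have "poly (q mod d) z = 0" if "z \<in> A" for z
      using d[OF that] q[OF that] by (metis add_0_left div_mult_mod_eq mult_zero_right poly_add poly_mult)
    then have "card A \<le> card {z. poly (q mod d) z = 0}"
      using nz by (intro card_mono poly_roots_finite) auto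
    then have "degree d \<le> degree (q mod d)"
      using card_poly_roots_bound[OF nz] assms(3) by linarith
    then show False
      using degree_mod_less[OF assms(1)] nz by (meson leD)
  qed
  then show ?thesis by (simp add: dvd_eq_mod_eq_0)
qed

section \<open>Functions with poles in a single orbit\<close>

text \<open>The form a F_1^2 + b F_2^N at Y = 1, expanded in powers of \<lambda>^N.\<close>

definition orbit_poly :: "nat \<Rightarrow> complex \<Rightarrow> complex \<Rightarrow> complex poly" where
  "orbit_poly N a b = smult (a / 4) (monom 1 (2 * N)) + smult (a / 2 + b) (monom 1 N) + [:a / 4:]"

lemma poly_orbit_poly: "poly (orbit_poly N a b) z = a * ((z ^ N + 1) / 2)\<^sup>2 + b * z ^ N"
proof -
  have "a / 4 * x\<^sup>2 + (a / 2 + b) * x + a / 4 = a * ((x + 1) / 2)\<^sup>2 + b * x" for x :: complex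
    by (simp add: power2_eq_square algebra_simps add_divide_distrib)
  from this[of "z ^ N"] show ?thesis
    by (simp add: orbit_poly_def poly_monom power_even_eq)
qed

lemma degree_orbit_poly: "degree (orbit_poly N a b) \<le> 2 * N"
  unfolding orbit_poly_def
  by (intro degree_add_le order_trans[OF degree_smult_le] order_trans[OF degree_monom_le]) auto

lemma lead_coeff_orbit_poly: "N > 0 \<Longrightarrow> poly.coeff (orbit_poly N a b) (2 * N) = a / 4"
  by (auto simp: orbit_poly_def coeff_pCons split: nat.splits)

lemma orbit_poly_nonzero:
  assumes "N > 0" "(a, b) \<noteq> (0, 0)"
  shows "orbit_poly N a b \<noteq> 0"
proof (cases "a = 0")
  case True
  then have "poly.coeff (orbit_poly N a b) N = b"
    using assms(1) by (auto simp: orbit_poly_def coeff_pCons split: nat.splits)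
  with True assms show ?thesis by force
next
  case False
  then show ?thesis using lead_coeff_orbit_poly[OF assms(1), of a b] by force
qed

lemma degree_orbit_poly_0: "degree (orbit_poly N 0 b) \<le> N"
  by (simp add: orbit_poly_def smult_monom degree_monom_le)

lemma form_orbit_mero_eq:
  "form_orbit_mero N a b = const_mero a * ((lam ^ N + 1) / 2)\<^sup>2 + const_mero b * lam ^ N"
  by (simp add: form_orbit_def form_def)

lemma to_fract_orbit_poly: "to_fract (orbit_poly N a b) = form_orbit_mero N a b"
proof -
  have "to_fract (orbit_poly N a b) =
      const_mero a / 4 * lam ^ (2 * N) + (const_mero a / 2 + const_mero b) * lam ^ N + const_mero a / 4"
    by (simp add: orbit_poly_def smult_monom to_fract_monom flip: const_mero_def)
  also have "\<dots> = form_orbit_mero N a b"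
    by (simp add: form_orbit_mero_eq divide_simps power2_eq_square mult_2 power_add) (simp add: algebra_simps)
  finally show ?thesis .
qed

lemma mero_comp_orbit_rotation:
  assumes "c ^ N = 1" "N > 0"
  shows "mero_comp (form_orbit_mero N a b) (const_mero c * lam) = form_orbit_mero N a b"
proof -
  have "(const_mero c * lam) ^ N = lam ^ N"
    using assms by (simp add: power_mult_distrib flip: const_mero_power)
  moreover have "const_mero c * lam \<notin> range const_mero"
    using assms by (intro lam_multiple_nonconst) (auto simp: power_0_left)
  ultimately show ?thesis
    by (simp add: form_orbit_mero_eq mero_comp_hom)
qed

text \<open>The factor \<open>lam ^ (2 * N)\<close> is the weight of a form of degree 2N. It does
  not depend on \<open>a\<close> and \<open>b\<close>, so it cancels in quotients of two members of
  the pencil.\<close>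

lemma mero_comp_orbit_reflection:
  assumes "c ^ N = 1" "N > 0"
  shows "mero_comp (form_orbit_mero N a b) (const_mero c / lam) = form_orbit_mero N a b / lam ^ (2 * N)"
proof -
  have "(const_mero c / lam) ^ N = 1 / lam ^ N"
    using assms by (simp add: power_divide flip: const_mero_power)
  moreover have "const_mero c / lam \<notin> range const_mero"
    using assms by (intro lam_inverse_multiple_nonconst) (auto simp: power_0_left)
  ultimately show ?thesis
    by (simp add: form_orbit_mero_eq mero_comp_hom power_mult mult.commute[of 2] divide_simps)
      (simp add: algebra_simps power2_eq_square)
qed

lemma zero_set_form_orbit_finite:
  "Some z \<in> zero_set (form_orbit N a b) \<longleftrightarrow> poly (orbit_poly N a b) z = 0"
  by (simp add: zero_set_def coords_of_def form_orbit_def form_def poly_orbit_poly)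

lemma zero_set_form_orbit_infinity:
  "N > 0 \<Longrightarrow> None \<in> zero_set (form_orbit N a b) \<longleftrightarrow> a = 0"
  by (simp add: zero_set_def coords_of_def form_orbit_def form_def power_0_left)

locale single_orbit =
  fixes N :: nat and c1 c2 :: complex
  assumes N_pos: "N > 0" and c_nonzero: "(c1, c2) \<noteq> (0, 0)"
begin

abbreviation F :: mero where "F \<equiv> form_orbit_mero N c1 c2"
abbreviation FP :: "complex poly" where "FP \<equiv> orbit_poly N c1 c2"

lemma FP_nonzero: "FP \<noteq> 0"
  using orbit_poly_nonzero N_pos c_nonzero by blast

lemma F_nonzero: "F \<noteq> 0"
  using FP_nonzero by (simp flip: to_fract_orbit_poly)

text \<open>Quotients \<open>P/F\<^sup>m\<close> of forms of equal degree, in the affine coordinate.\<close>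

definition S :: "mero set" where
  "S = {to_fract p / F ^ m | p m. degree p \<le> 2 * N * m}"

lemma S_I: "f = to_fract p / F ^ m \<Longrightarrow> degree p \<le> 2 * N * m \<Longrightarrow> f \<in> S"
  by (auto simp: S_def)

lemma S_frac: "degree p \<le> 2 * N \<Longrightarrow> to_fract p / F \<in> S"
  by (rule S_I[of _ p 1]) auto

lemma S_raise:
  assumes "degree p \<le> 2 * N * m"
  shows "degree (p * FP ^ k) \<le> 2 * N * (m + k)"
    and "to_fract p / F ^ m = to_fract (p * FP ^ k) / F ^ (m + k)"
proof -
  have "degree (FP ^ k) \<le> 2 * N * k"
    using degree_power_le[of FP k] degree_orbit_poly[of N c1 c2]
    by (meson le_trans mult_le_mono1)
  then show "degree (p * FP ^ k) \<le> 2 * N * (m + k)"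
    using degree_mult_le[of p "FP ^ k"] assms by (simp add: ring_distribs)
  show "to_fract p / F ^ m = to_fract (p * FP ^ k) / F ^ (m + k)"
    using F_nonzero by (simp add: to_fract_power to_fract_orbit_poly power_add)
qed

lemma S_const: "const_mero c \<in> S"
  by (rule S_I[of _ "[:c:]" 0]) (auto simp: const_mero_def)

lemma S_mult: "f \<in> S \<Longrightarrow> g \<in> S \<Longrightarrow> f * g \<in> S"
proof -
  assume "f \<in> S" "g \<in> S"
  then obtain p m q n where *: "f = to_fract p / F ^ m" "degree p \<le> 2 * N * m"
    "g = to_fract q / F ^ n" "degree q \<le> 2 * N * n"
    by (auto simp: S_def)
  show ?thesis
  proof (rule S_I)
    show "f * g = to_fract (p * q) / F ^ (m + n)"
      by (simp add: * power_add)
    show "degree (p * q) \<le> 2 * N * (m + n)"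
      using * degree_mult_le[of p q] by (simp add: ring_distribs)
  qed
qed

lemma S_add: "f \<in> S \<Longrightarrow> g \<in> S \<Longrightarrow> f + g \<in> S"
proof -
  assume "f \<in> S" "g \<in> S"
  then obtain p m q n where *: "f = to_fract p / F ^ m" "degree p \<le> 2 * N * m"
    "g = to_fract q / F ^ n" "degree q \<le> 2 * N * n"
    by (auto simp: S_def)
  show ?thesis
  proof (rule S_I)
    show "f + g = to_fract (p * FP ^ n + q * FP ^ m) / F ^ (m + n)"
      unfolding *(1,3) S_raise(2)[OF *(2), of n] S_raise(2)[OF *(4), of m]
      by (simp add: add.commute[of n m] add_divide_distrib)
    show "degree (p * FP ^ n + q * FP ^ m) \<le> 2 * N * (m + n)"
      using S_raise(1)[OF *(2), of n] S_raise(1)[OF *(4), of m]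
      by (intro degree_add_le) (auto simp: add.commute)
  qed
qed

lemma S_minus: "f \<in> S \<Longrightarrow> - f \<in> S"
  using S_mult[OF S_const[of "-1"], of f] by simp

lemma S_diff: "f \<in> S \<Longrightarrow> g \<in> S \<Longrightarrow> f - g \<in> S"
  using S_add[of f "- g"] S_minus[of g] by simp

lemma S_divide_numeral: "f \<in> S \<Longrightarrow> f / numeral n \<in> S"
  using S_mult[OF _ S_const[of "1 / numeral n"]] by simp

text \<open>Finite poles lie among the zeros of F, so the reduced denominator divides a power of F.
  If \<open>c1\<close> is nonzero, F has full degree 2N and the degree bound in \<open>S\<close> is
  regularity at infinity. If \<open>c1 = 0\<close>, infinity belongs to the zero set and the bound
  must come for free.\<close>

lemma S_iff_analytic:
  "f \<in> S \<longleftrightarrow> (\<forall>p \<in> - zero_set (form_orbit N c1 c2). mero_analytic_at f p)"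
proof
  assume "f \<in> S"
  then obtain p m where f: "f = to_fract p / to_fract (FP ^ m)" and deg: "degree p \<le> 2 * N * m"
    by (auto simp: S_def to_fract_power to_fract_orbit_poly)
  show "\<forall>P \<in> - zero_set (form_orbit N c1 c2). mero_analytic_at f P"
  proof
    fix P assume P: "P \<in> - zero_set (form_orbit N c1 c2)"
    show "mero_analytic_at f P"
    proof (cases P)
      case None
      then have "c1 \<noteq> 0"
        using P zero_set_form_orbit_infinity[OF N_pos] by auto
      then have "degree FP \<ge> 2 * N"
        by (intro le_degree) (simp add: lead_coeff_orbit_poly[OF N_pos])
      then have "degree (FP ^ m) \<ge> 2 * N * m"
        using FP_nonzero by (simp add: degree_power_eq mult.commute)
      then show ?thesis
        using None deg FP_nonzero by (simp add: f mero_analytic_at_infinity_iff)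
    next
      case (Some z)
      then have "poly (FP ^ m) z \<noteq> 0"
        using P by (simp add: zero_set_form_orbit_finite)
      then show ?thesis
        unfolding Some mero_analytic_at_finite_iff using f by blast
    qed
  qed
next
  assume an: "\<forall>P \<in> - zero_set (form_orbit N c1 c2). mero_analytic_at f P"
  obtain p q where q0: "q \<noteq> 0" and cop: "coprime p q" and f: "f = to_fract p / to_fract q"
    by (rule quot_of_fract_cases)
  define n where "n = degree q"
  have "poly FP z = 0" if z: "poly q z = 0" for z
  proof (rule ccontr)
    assume "poly FP z \<noteq> 0"
    with an have "mero_analytic_at f (Some z)"
      by (auto simp: zero_set_form_orbit_finite)
    then obtain p' q' where pq': "f = to_fract p' / to_fract q'" "poly q' z \<noteq> 0"
      unfolding mero_analytic_at_finite_iff by blast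
    then have "q' \<noteq> 0" by auto
    then have "p * q' = p' * q"
      using f pq' q0 to_fract_divide_eq_iff[of q q' p p'] by simp
    then have "q dvd q'"
      using cop by (metis coprime_commute coprime_dvd_mult_right_iff dvd_triv_right)
    then show False
      using z pq'(2) by (auto elim!: dvdE)
  qed
  then have "q dvd FP ^ n"
    unfolding n_def by (intro dvd_power_degree_if_roots_subset q0)
  then obtain r where r: "FP ^ n = q * r" by blast
  have r0: "r \<noteq> 0"
    using r FP_nonzero by auto
  have f': "f = to_fract (p * r) / F ^ n"
  proof -
    have "F ^ n = to_fract q * to_fract r"
      by (simp flip: to_fract_orbit_poly to_fract_power add: r)
    then show ?thesis using r0 q0 by (simp add: f)
  qed
  show "f \<in> S"
  proof (cases "c1 = 0")
    case False
    with an have "mero_analytic_at f None"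
      using zero_set_form_orbit_infinity[OF N_pos] by auto
    then have "degree p \<le> degree q"
      using q0 f by (simp add: mero_analytic_at_infinity_iff)
    then have "degree (p * r) \<le> degree (q * r)"
      using degree_mult_le[of p r] degree_mult_eq[OF q0 r0] by simp
    also have "\<dots> \<le> 2 * N * n"
      using degree_orbit_poly[of N c1 c2] FP_nonzero by (simp flip: r add: degree_power_eq mult.commute)
    finally show ?thesis using f' by (rule S_I[rotated])
  next
    case True
    \<comment> \<open>Now F has degree at most N. Each additional factor of F raises the degree of
      the numerator by at most N but the permitted degree by 2N, so \<open>k\<close> factors make up
      for a numerator of degree \<open>k\<close>.\<close>
    define k where "k = degree (p * r)"
    have "degree (FP ^ k) \<le> N * k"
      using True degree_orbit_poly_0[of N c2] FP_nonzero by (simp add: degree_power_eq mult.commute)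
    moreover have "k \<le> N * k" using N_pos by simp
    ultimately have "degree (p * r * FP ^ k) \<le> N * k + N * k"
      using degree_mult_le[of "p * r" "FP ^ k"] unfolding k_def[symmetric] by linarith
    then have "degree (p * r * FP ^ k) \<le> 2 * N * (n + k)"
      by (simp add: ring_distribs)
    moreover have "f = to_fract (p * r * FP ^ k) / F ^ (n + k)"
      using F_nonzero f' by (simp add: to_fract_power to_fract_orbit_poly power_add)
    ultimately show ?thesis by (intro S_I)
  qed
qed

lemma inverse_lam_nonconst: "1 / lam \<notin> range const_mero"
  using lam_inverse_multiple_nonconst[of 1] by simp

lemma mero_comp_S_frac:
  assumes "degree p \<le> 2 * N * m"
  shows "mero_comp (to_fract p / F ^ m) (1 / lam) = to_fract (rev_poly (2 * N * m) p) / F ^ m"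
proof -
  have "mero_comp (to_fract p / F ^ m) (1 / lam) = mero_poly p (1 / lam) / (F / lam ^ (2 * N)) ^ m"
    using mero_comp_orbit_reflection[of 1 N c1 c2] N_pos
    by (simp add: mero_comp_divide mero_comp_power mero_comp_to_fract inverse_lam_nonconst)
  also have "\<dots> = mero_poly p (1 / lam) * lam ^ (2 * N * m) / F ^ m"
    by (simp add: power_divide power_mult)
  finally show ?thesis
    by (simp add: mero_poly_inverse_lam[OF assms])
qed

lemma S_reflection:
  assumes "f \<in> S"
  shows "mero_comp f (1 / lam) \<in> S"
proof -
  obtain p m where f: "f = to_fract p / F ^ m" "degree p \<le> 2 * N * m"
    using assms by (auto simp: S_def)
  show ?thesis
    unfolding f(1) mero_comp_S_frac[OF f(2)] by (rule S_I[OF refl degree_rev_poly])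
qed

lemma root_of_unity_nonzero: "(c :: complex) ^ N = 1 \<Longrightarrow> c \<noteq> 0"
  using N_pos by (cases "c = 0") (auto simp: zero_power)

lemma mero_comp_S_frac_rotation:
  assumes "c ^ N = 1"
  shows "mero_comp (to_fract p / F ^ m) (const_mero c * lam) = to_fract (pcompose p [:0, c:]) / F ^ m"
proof -
  have nc: "const_mero c * lam \<notin> range const_mero"
    using root_of_unity_nonzero[OF assms] by (rule lam_multiple_nonconst)
  have "mero_poly p (const_mero c * lam) = to_fract (pcompose p [:0, c:])"
  proof -
    have "mero_poly [:0, c:] lam = const_mero c * lam"
      by (simp del: mero_poly_lam)
    then show ?thesis
      by (metis mero_poly_lam mero_poly_pcompose)
  qed
  then show ?thesis
    using mero_comp_orbit_rotation[OF assms N_pos, of c1 c2]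
    by (simp add: mero_comp_divide mero_comp_power mero_comp_to_fract nc)
qed

text \<open>As F is invariant under rotations, an eigenvalue of the function is one of its
  numerator. The eigenvalue is 1 for invariant functions and a power of \<open>c\<close> for an
  entry off the diagonal.\<close>

lemma rotation_eigen:
  assumes "c ^ N = 1" "mero_comp (to_fract p / F ^ m) (const_mero c * lam) = const_mero a * (to_fract p / F ^ m)"
  shows "pcompose p [:0, c:] = smult a p"
proof -
  have "to_fract (pcompose p [:0, c:]) = const_mero a * to_fract p"
    using assms(2) F_nonzero unfolding mero_comp_S_frac_rotation[OF assms(1)] by simp
  also have "\<dots> = to_fract (smult a p)"
    by (simp add: to_fract_smult)
  finally show ?thesis by simp
qed

lemma reflection_eigen:
  assumes "degree p \<le> 2 * N * m"
    and "mero_comp (to_fract p / F ^ m) (1 / lam) = const_mero a * (to_fract p / F ^ m)"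
    and "z \<noteq> 0"
  shows "z ^ (2 * N * m) * poly p (inverse z) = a * poly p z"
proof -
  have "to_fract (rev_poly (2 * N * m) p) = const_mero a * to_fract p"
    using assms(2) F_nonzero unfolding mero_comp_S_frac[OF assms(1)] by simp
  also have "\<dots> = to_fract (smult a p)"
    by (simp add: to_fract_smult)
  finally have "rev_poly (2 * N * m) p = smult a p" by simp
  then show ?thesis
    using poly_rev_poly[OF assms(1,3)] by simp
qed

definition rotation_invariant :: "mero \<Rightarrow> bool" where
  "rotation_invariant f \<longleftrightarrow> (\<forall>c. c ^ N = 1 \<longrightarrow> mero_comp f (const_mero c * lam) = f)"

lemma poly_rotation_invariant:
  assumes "rotation_invariant (to_fract p / F ^ m)" "c ^ N = 1"
  shows "poly p (c * z) = poly p z"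
proof -
  have "pcompose p [:0, c:] = smult 1 p"
    using assms by (intro rotation_eigen[of _ _ m]) (simp_all add: rotation_invariant_def)
  then show ?thesis
    using poly_pcompose[of p "[:0, c:]" z] by (simp add: mult.commute)
qed

text \<open>An antiinvariant function vanishes at the fixed points of the reflections, which are the zeros of
  \<open>F\<^sub>0 F\<^sub>1\<close>.\<close>

lemma antiinvariant_divisible:
  assumes "f \<in> S" "rotation_invariant f" "mero_comp f (1 / lam) = - f"
  shows "f * (F / (form_mero N 0 * form_mero N 1)) \<in> S"
proof -
  obtain p0 m where p0: "f = to_fract p0 / F ^ m" "degree p0 \<le> 2 * N * m"
    using assms(1) by (auto simp: S_def)
  \<comment> \<open>Writing \<open>f\<close> with one more factor of F leaves room for the division
    by \<open>d\<close>, of degree 2N, also when \<open>m = 0\<close>.\<close>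
  define p where "p = p0 * FP"
  have f: "f = to_fract p / F ^ Suc m" and deg: "degree p \<le> 2 * N * Suc m"
    using S_raise[OF p0(2), of 1] p0(1) by (auto simp: p_def)
  define d :: "complex poly" where "d = monom 1 (2 * N) - 1"
  have d_eval: "poly d z = z ^ (2 * N) - 1" for z
    by (simp add: d_def poly_monom)
  have d_coeff: "poly.coeff d (2 * N) = 1"
    using N_pos by (simp add: d_def)
  then have d0: "d \<noteq> 0" by force
  have "degree d \<le> 2 * N"
    unfolding d_def by (intro degree_diff_le) (auto intro: degree_monom_le)
  moreover have "degree d \<ge> 2 * N"
    using d_coeff by (intro le_degree) simp
  ultimately have deg_d: "degree d = 2 * N" by simp
  have "d dvd p"
  proof (rule dvd_if_roots[OF d0])
    show "degree d \<le> card {z::complex. z ^ (2 * N) = 1}"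
      using card_nth_roots[of 1 "2 * N"] N_pos deg_d by simp
    show "finite {z::complex. z ^ (2 * N) = 1}"
      using N_pos by (intro finite_nth_roots) simp
  next
    fix z :: complex assume z: "z \<in> {z. z ^ (2 * N) = 1}"
    then show "poly d z = 0" by (simp add: d_eval)
    have z0: "z \<noteq> 0" using z N_pos by (auto simp: power_0_left)
    have "z ^ (2 * N * Suc m) * poly p (inverse z) = (- 1) * poly p z"
      using assms(3) unfolding f by (intro reflection_eigen[OF deg _ z0]) simp
    moreover have "z ^ (2 * N * Suc m) = 1"
      using z by (simp only: power_mult) simp
    moreover have "poly p (inverse z) = poly p z"
    proof -
      \<comment> \<open>The rotation by z^(-2) takes z to 1/z, and z^(2N) = 1 makes it a rotation of
        the group. So \<open>p\<close> has equal values at z and 1/z, while antiinvariance makes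
        them opposite.\<close>
      have "(inverse z)\<^sup>2 ^ N = 1"
        using z by (simp add: power_inverse flip: power_mult)
      from poly_rotation_invariant[OF assms(2)[unfolded f] this, of z] show ?thesis
        using z0 by (simp add: power2_eq_square mult.assoc)
    qed
    ultimately show "poly p z = 0" by simp
  qed
  then obtain r where r: "p = d * r" by blast
  have degr: "degree r \<le> 2 * N * m"
  proof (cases "r = 0")
    case False
    then have "degree p = 2 * N + degree r"
      using d0 by (simp add: r degree_mult_eq deg_d)
    then show ?thesis using deg by simp
  qed auto
  have FF: "form_mero N 0 * form_mero N 1 = to_fract d / 4"
    by (simp add: form_def d_def to_fract_monom mult_2 power_add) (simp add: algebra_simps)
  have "f * (F / (form_mero N 0 * form_mero N 1)) = to_fract (smult 4 r) / F ^ m"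
  proof -
    have "to_fract (smult 4 r) = 4 * to_fract r"
      by (simp add: to_fract_smult)
    then show ?thesis
      unfolding FF f r using d0 F_nonzero by (simp add: field_simps)
  qed
  then show ?thesis
    using degr by (intro S_I[of _ "smult 4 r" m]) (auto intro: order_trans[OF degree_smult_le])
qed

end

section \<open>The ring of polynomials in the invariant function t\<close>

lemma adjoin_const: "const_mero c \<in> adjoin t"
  unfolding adjoin_def by (rule range_eqI[of _ _ "[:c:]"]) (simp add: map_poly_pCons)

lemma adjoin_self: "t \<in> adjoin t"
  unfolding adjoin_def by (rule range_eqI[of _ _ "[:0, 1:]"]) (simp add: map_poly_pCons)

lemma adjoin_add: "f \<in> adjoin t \<Longrightarrow> g \<in> adjoin t \<Longrightarrow> f + g \<in> adjoin t"
  unfolding adjoin_def mero_poly_def[symmetric] by (auto simp flip: mero_poly_add)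

lemma adjoin_mult: "f \<in> adjoin t \<Longrightarrow> g \<in> adjoin t \<Longrightarrow> f * g \<in> adjoin t"
  unfolding adjoin_def mero_poly_def[symmetric] by (auto simp flip: mero_poly_mult)

lemma adjoin_diff: "f \<in> adjoin t \<Longrightarrow> g \<in> adjoin t \<Longrightarrow> f - g \<in> adjoin t"
  unfolding adjoin_def mero_poly_def[symmetric] by (auto simp flip: mero_poly_diff)

lemma adjoin_induct [consumes 1, case_names const step]:
  assumes "f \<in> adjoin t" "\<And>c. P (const_mero c)" "\<And>c g. P g \<Longrightarrow> P (const_mero c + t * g)"
  shows "P f"
proof -
  obtain p where f: "f = mero_poly p t"
    using assms(1) by (auto simp: adjoin_def mero_poly_def)
  show ?thesis
    unfolding f by (induction p) (use assms(2)[of 0] assms(3) in auto)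
qed

context single_orbit
begin

context
  fixes d1 d2 :: complex and t :: mero
  assumes independent: "c1 * d2 \<noteq> c2 * d1"
  defines "t \<equiv> form_orbit_mero N d1 d2 / F"
begin

lemma t_rotation: "c ^ N = 1 \<Longrightarrow> mero_comp t (const_mero c * lam) = t"
  by (simp add: t_def mero_comp_divide mero_comp_orbit_rotation lam_multiple_nonconst root_of_unity_nonzero N_pos)

lemma t_reflection: "c ^ N = 1 \<Longrightarrow> mero_comp t (const_mero c / lam) = t"
  by (simp add: t_def mero_comp_divide mero_comp_orbit_reflection lam_inverse_multiple_nonconst
      root_of_unity_nonzero N_pos)

lemma t_in_S: "t \<in> S"
  unfolding t_def to_fract_orbit_poly[symmetric, of N d1 d2] by (intro S_frac degree_orbit_poly)

lemma adjoin_t_in_S: "f \<in> adjoin t \<Longrightarrow> f \<in> S"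
  by (induction rule: adjoin_induct) (auto intro: S_const S_add S_mult t_in_S)

lemma adjoin_t_rotation:
  "f \<in> adjoin t \<Longrightarrow> c ^ N = 1 \<Longrightarrow> mero_comp f (const_mero c * lam) = f"
  by (induction rule: adjoin_induct)
    (simp_all add: mero_comp_hom lam_multiple_nonconst root_of_unity_nonzero t_rotation)

lemma adjoin_t_reflection:
  "f \<in> adjoin t \<Longrightarrow> c ^ N = 1 \<Longrightarrow> mero_comp f (const_mero c / lam) = f"
  by (induction rule: adjoin_induct)
    (simp_all add: mero_comp_hom lam_inverse_multiple_nonconst root_of_unity_nonzero t_reflection)

text \<open>Subtracting the value at a generic point \<open>z\<close> makes an invariant function vanish on the whole
  orbit of \<open>z\<close>; dividing by \<open>t - t(z)\<close>, whose zeros are exactly the points of this orbit, lowers the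
  order of the poles.\<close>

lemma invariant_frac_in_adjoin:
  assumes "degree p \<le> 2 * N * m" "f = to_fract p / F ^ m"
    and "rotation_invariant f" "mero_comp f (1 / lam) = f"
  shows "f \<in> adjoin t"
  using assms
proof (induction m arbitrary: p f)
  case 0
  then obtain a where "p = [:a:]"
    by (auto elim!: degree_eq_zeroE)
  then show ?case
    using 0 adjoin_const[of a] by (simp add: const_mero_def)
next
  case (Suc m)
  \<comment> \<open>A point where \<open>g\<close> does not vanish is generic: it is not 0, its
    orbit has the full number 2N of points, and it is not a pole.\<close>
  define g :: "complex poly" where "g = [:0, 1:] * (monom 1 (2 * N) - 1) * FP"
  have "monom 1 (2 * N) \<noteq> (1 :: complex poly)"
    using N_pos degree_monom_eq[of "1::complex" "2 * N"] by force
  then have "g \<noteq> 0"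
    using FP_nonzero by (auto simp: g_def)
  then obtain z where "poly g z \<noteq> 0"
    using poly_all_0_iff_0 by blast
  then have z: "z \<noteq> 0" "z ^ (2 * N) \<noteq> 1" "poly FP z \<noteq> 0"
    by (auto simp: g_def poly_monom)
  define \<tau> where "\<tau> = poly (orbit_poly N d1 d2) z / poly FP z"
  \<comment> \<open>The numerator of \<open>t - \<tau>\<close>, where \<open>\<tau>\<close> is the
    value of t at z. It is again a member of the pencil, and independence keeps it from being
    zero.\<close>
  define K where "K = orbit_poly N (d1 - \<tau> * c1) (d2 - \<tau> * c2)"
  have K: "K = orbit_poly N d1 d2 - smult \<tau> FP"
    by (intro poly_eq_poly_eq_iff[THEN iffD1] ext)
      (simp add: K_def poly_orbit_poly left_diff_distrib distrib_left mult.assoc)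
  have K0: "K \<noteq> 0"
    unfolding K_def
  proof (rule orbit_poly_nonzero[OF N_pos], rule notI)
    assume "(d1 - \<tau> * c1, d2 - \<tau> * c2) = (0, 0)"
    then have "d1 = \<tau> * c1" "d2 = \<tau> * c2" by auto
    then show False using independent by simp
  qed
  have Kt: "to_fract K / F = t - const_mero \<tau>"
  proof -
    have "to_fract (smult \<tau> FP) = const_mero \<tau> * F"
      by (simp add: to_fract_smult to_fract_orbit_poly)
    then show ?thesis
      using F_nonzero unfolding K t_def by (simp add: to_fract_orbit_poly diff_divide_distrib)
  qed
  define A where "A = {w. w ^ N = z ^ N} \<union> {w. w ^ N = inverse z ^ N}"
  have finA: "finite A"
    unfolding A_def using N_pos finite_nth_roots by blast
  have "{w. w ^ N = z ^ N} \<inter> {w. w ^ N = inverse z ^ N} = {}"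
  proof -
    have "z ^ N * z ^ N \<noteq> 1"
      using z(2) by (simp add: mult_2 power_add)
    then show ?thesis
      using z(1) by (auto simp: power_inverse field_simps)
  qed
  then have cardA: "card A = 2 * N"
    unfolding A_def using z(1) N_pos finite_nth_roots
    by (subst card_Un_disjoint) (auto simp: card_nth_roots)
  \<comment> \<open>Values of a form at Y = 1 are not constant on orbits: on the points of the
    reflected coset a form of degree 2N acquires the factor z^(-2N). The numerator \<open>p\<close>
    acquires its power \<open>Suc m\<close>, just as the matching power of F does, so the difference
    \<open>q\<close> below vanishes on the whole orbit.\<close>
  have orbit_eval: "poly (orbit_poly N a b) w = (if w ^ N = z ^ N then 1 else inverse z ^ (2 * N)) *
      poly (orbit_poly N a b) z" if "w \<in> A" for a b w
  proof (cases "w ^ N = z ^ N")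
    case False
    with that have "w ^ N = inverse z ^ N" by (auto simp: A_def)
    moreover have "a * ((inverse x + 1) / 2)\<^sup>2 + b * inverse x =
        (inverse x)\<^sup>2 * (a * ((x + 1) / 2)\<^sup>2 + b * x)" if "x \<noteq> 0" for x
      using that by (simp add: power2_eq_square field_simps)
    from this[of "z ^ N"] have "a * ((inverse z ^ N + 1) / 2)\<^sup>2 + b * inverse z ^ N =
        inverse z ^ (2 * N) * (a * ((z ^ N + 1) / 2)\<^sup>2 + b * z ^ N)"
      using z(1) by (simp add: power_inverse power_even_eq)
    ultimately show ?thesis
      using False by (simp only: poly_orbit_poly if_False)
  qed (simp add: poly_orbit_poly)
  have p_eval: "poly p w = (if w ^ N = z ^ N then 1 else inverse z ^ (2 * N)) ^ Suc m * poly p z"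
    if "w \<in> A" for w
  proof (cases "w ^ N = z ^ N")
    case True
    then have "(w / z) ^ N = 1" using z(1) by (simp add: power_divide)
    from poly_rotation_invariant[OF Suc.prems(3)[unfolded Suc.prems(2)] this, of z] show ?thesis
      using z(1) True by simp
  next
    case False
    with that have "w ^ N = inverse z ^ N" by (auto simp: A_def)
    then have "(w * z) ^ N = 1" using z(1) by (simp add: power_mult_distrib power_inverse)
    then have "poly p (w * z * inverse z) = poly p (inverse z)"
      by (rule poly_rotation_invariant[OF Suc.prems(3)[unfolded Suc.prems(2)]])
    moreover have "w * z * inverse z = w"
      using z(1) by simp
    ultimately have "poly p w = poly p (inverse z)"
      by metis
    moreover have "z ^ (2 * N * Suc m) * poly p (inverse z) = 1 * poly p z"
      using Suc.prems(4) unfolding Suc.prems(2)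
      by (intro reflection_eigen[OF Suc.prems(1) _ z(1)]) simp
    moreover have "(inverse z ^ (2 * N)) ^ Suc m * z ^ (2 * N * Suc m) = 1"
      using z(1) by (simp only: power_mult[symmetric] power_inverse) simp
    then have "(inverse z ^ (2 * N)) ^ Suc m * (z ^ (2 * N * Suc m) * poly p (inverse z)) =
        poly p (inverse z)"
      by (simp only: mult.assoc[symmetric] mult_1)
    ultimately show ?thesis
      using False by (simp only: if_False mult_1)
  qed
  define v where "v = poly p z / poly FP z ^ Suc m"
  define q where "q = p - smult v (FP ^ Suc m)"
  have "poly K z = 0"
    using z(3) by (simp add: K \<tau>_def)
  then have KA: "poly K w = 0" if "w \<in> A" for w
    using orbit_eval[OF that] unfolding K_def by simp
  have qA: "poly q w = 0" if "w \<in> A" for w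
    using p_eval[OF that] orbit_eval[OF that, of c1 c2] z(3)
    by (simp add: q_def v_def power_mult_distrib del: power_Suc)
  have degK: "degree K \<le> 2 * N"
    unfolding K_def by (rule degree_orbit_poly)
  have "K dvd q"
    using K0 finA cardA degK KA qA by (intro dvd_if_roots[of K A]) auto
  then obtain r where r: "q = K * r" by blast
  \<comment> \<open>With 2N zeros, K has degree exactly 2N; hence dividing by K lowers the degree
    bound by a full 2N, and with it the exponent of F.\<close>
  have degK': "2 * N \<le> degree K"
    using card_mono[OF poly_roots_finite[OF K0], of A] KA card_poly_roots_bound[OF K0] cardA by force
  have "degree q \<le> 2 * N * Suc m"
    unfolding q_def using Suc.prems(1) S_raise(1)[of 1 0 "Suc m"]
    by (intro degree_diff_le order_trans[OF degree_smult_le]) auto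
  then have degr: "degree r \<le> 2 * N * m"
    using degK' K0 by (cases "r = 0") (auto simp: r degree_mult_eq)
  define h where "h = to_fract r / F ^ m"
  have fh: "f = const_mero v + (t - const_mero \<tau>) * h"
  proof -
    have "to_fract q = to_fract p - const_mero v * F ^ Suc m"
      by (simp add: q_def to_fract_smult to_fract_power to_fract_orbit_poly del: power_Suc)
    then have "to_fract p = const_mero v * F ^ Suc m + to_fract K * to_fract r"
      by (simp add: r)
    then show ?thesis
      using F_nonzero unfolding Suc.prems(2) h_def Kt[symmetric] by (simp add: add_divide_distrib)
  qed
  have t\<tau>: "t - const_mero \<tau> \<noteq> 0"
    using K0 F_nonzero by (simp flip: Kt)
  \<comment> \<open>Invariance of \<open>h\<close> is not visible from the quotient polynomial
    \<open>r\<close>, but it is from this expression in the invariants \<open>f\<close> and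
    \<open>t\<close>.\<close>
  then have h: "h = (f - const_mero v) / (t - const_mero \<tau>)"
    by (simp add: fh)
  have "h \<in> adjoin t"
  proof (rule Suc.IH[OF degr h_def])
    show "rotation_invariant h"
      unfolding rotation_invariant_def
    proof (intro allI impI)
      fix c :: complex assume c: "c ^ N = 1"
      then have "const_mero c * lam \<notin> range const_mero"
        by (intro lam_multiple_nonconst root_of_unity_nonzero)
      then show "mero_comp h (const_mero c * lam) = h"
        unfolding h using c t_rotation[OF c] Suc.prems(3)
        by (simp add: mero_comp_hom rotation_invariant_def)
    qed
    show "mero_comp h (1 / lam) = h"
      unfolding h using t_reflection[of 1] Suc.prems(4)
      by (simp add: mero_comp_hom inverse_lam_nonconst)
  qed
  then show ?case
    unfolding fh by (intro adjoin_add adjoin_mult adjoin_diff adjoin_const adjoin_self)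
qed

lemma invariant_in_adjoin:
  assumes "f \<in> S" "rotation_invariant f" "mero_comp f (1 / lam) = f"
  shows "f \<in> adjoin t"
  using assms invariant_frac_in_adjoin unfolding S_def by blast

end

end

section \<open>The group actions\<close>

lemma omega_power_N: "N > 0 \<Longrightarrow> (omega (cover_index N) powi (2 * l)) ^ N = 1"
proof -
  assume N: "N > 0"
  have "(omega (cover_index N) powi (2 * l)) ^ N = omega (cover_index N) powi (2 * (l * int N))"
    by (simp only: mult.assoc[symmetric] power_int_mult power_int_of_nat)
  also have "\<dots> = 1"
    using N cover2[of N "l * int N"] by (subst omega_powi_eq_1_iff) (auto simp: cover_index_def)
  finally show ?thesis .
qed

text \<open>The powers with \<open>0 \<le> l < N\<close> are N distinct N-th roots of unity, hence
  all of them. This allows elements of the group to be replaced by roots of unity.\<close>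

lemma root_of_unity_eq_omega_power:
  assumes "N > 0" "c ^ N = 1"
  obtains l where "l \<in> {0..<int N}" "c = omega (cover_index N) powi (2 * l)"
proof -
  let ?f = "\<lambda>l::int. omega (cover_index N) powi (2 * l)"
  have "inj_on ?f {0..<int N}"
  proof (rule inj_onI)
    fix l m assume lm: "l \<in> {0..<int N}" "m \<in> {0..<int N}" "?f l = ?f m"
    then have "omega (cover_index N) powi (2 * (l - m)) = 1"
      using omega_nonzero[of "cover_index N"] by (simp add: right_diff_distrib power_int_diff)
    then have "int N dvd l - m"
      using assms(1) cover2[of N "l - m"] by (subst (asm) omega_powi_eq_1_iff) (auto simp: cover_index_def)
    then have "l mod int N = m mod int N"
      by (simp only: mod_eq_dvd_iff)
    then show "l = m" using lm by simp
  qed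
  then have "card (?f ` {0..<int N}) = card {c::complex. c ^ N = 1}"
    using assms(1) by (simp add: card_image card_nth_roots)
  moreover have "?f ` {0..<int N} \<subseteq> {c. c ^ N = 1}"
    using omega_power_N[OF assms(1)] by auto
  ultimately have "?f ` {0..<int N} = {c. c ^ N = 1}"
    using assms(1) by (intro card_subset_eq finite_nth_roots) auto
  then show ?thesis using that assms(2) by blast
qed

text \<open>If \<open>c1\<close> is nonzero, F = 0 is a quadratic equation for u = \<lambda>^N whose
  two solutions are inverse to each other. So its zeros form one orbit, and an orbit contained in
  the zero set exhausts it. If \<open>c1 = 0\<close>, the zero set is {0, \<infinity>}.\<close>

lemma zero_set_form_orbit_eq:
  assumes "N > 0" "(c1, c2) \<noteq> (0, 0)"
    and "\<Gamma> \<in> orbits (dihedral N) UNIV (sphere_action N)" "\<Gamma> \<subseteq> zero_set (form_orbit N c1 c2)"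
  shows "zero_set (form_orbit N c1 c2) = \<Gamma>"
proof
  obtain P where \<Gamma>: "\<Gamma> = {sphere_action N g P | g. g \<in> carrier (dihedral N)}"
    using assms(3) by (auto simp: orbits_def orbit_def)
  have mem: "sphere_action N (l, b) P \<in> \<Gamma>" if "l \<in> {0..<int N}" for l b
    using that unfolding \<Gamma> by (auto simp: dihedral_def)
  have id: "P \<in> \<Gamma>"
    using mem[of 0 False] assms(1) by (simp add: sphere_action_eq split: option.splits)
  have swap: "sphere_action N (0, True) P \<in> \<Gamma>"
    using mem[of 0 True] assms(1) by simp
  show "zero_set (form_orbit N c1 c2) \<subseteq> \<Gamma>"
  proof (cases "c1 = 0")
    case True
    with assms(2) have "c2 \<noteq> 0" by simp
    have zs: "zero_set (form_orbit N c1 c2) = {Some 0, None}"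
    proof (intro Set.set_eqI)
      fix Q
      show "Q \<in> zero_set (form_orbit N c1 c2) \<longleftrightarrow> Q \<in> {Some 0, None}"
        using assms(1) True \<open>c2 \<noteq> 0\<close>
        by (cases Q) (auto simp: zero_set_form_orbit_finite zero_set_form_orbit_infinity poly_orbit_poly)
    qed
    then have "P = Some 0 \<or> P = None"
      using id assms(4) by blast
    then have "{Some 0, None} \<subseteq> \<Gamma>"
      using id swap by (auto simp: sphere_action_eq)
    then show ?thesis by (simp only: zs)
  next
    case False
    then have inf: "None \<notin> zero_set (form_orbit N c1 c2)"
      using zero_set_form_orbit_infinity[OF assms(1)] by blast
    have zero: "Some 0 \<notin> zero_set (form_orbit N c1 c2)"
      using False assms(1) by (simp add: zero_set_form_orbit_finite poly_orbit_poly power_0_left)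
    obtain z where P: "P = Some z" and z: "z \<noteq> 0"
      using id inf zero assms(4) by (cases P) auto
    show ?thesis
    proof
      fix Q assume Q: "Q \<in> zero_set (form_orbit N c1 c2)"
      then obtain w where w: "Q = Some w" "w \<noteq> 0"
        using inf zero by (cases Q) auto
      define u v where "u = z ^ N" and "v = w ^ N"
      have "c1 * ((u + 1) / 2)\<^sup>2 + c2 * u = 0" "c1 * ((v + 1) / 2)\<^sup>2 + c2 * v = 0"
        using id Q assms(4) P w unfolding u_def v_def
        by (auto simp: zero_set_form_orbit_finite poly_orbit_poly)
      \<comment> \<open>Elimination of \<open>c2\<close> from the two equations.\<close>
      moreover have "c1 * ((u - v) * (u * v - 1)) =
          4 * ((c1 * ((u + 1) / 2)\<^sup>2 + c2 * u) * v - (c1 * ((v + 1) / 2)\<^sup>2 + c2 * v) * u)"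
        by (simp add: power2_eq_square algebra_simps add_divide_distrib)
      ultimately have "c1 * ((u - v) * (u * v - 1)) = 0"
        by simp
      then have "u = v \<or> u * v = 1"
        using False by auto
      then show "Q \<in> \<Gamma>"
      proof
        assume "u = v"
        then have "(w / z) ^ N = 1"
          using z w(2) by (simp add: u_def v_def power_divide)
        then obtain l where "l \<in> {0..<int N}" "w / z = omega (cover_index N) powi (2 * l)"
          using root_of_unity_eq_omega_power[OF assms(1)] by blast
        then show ?thesis
          using mem[of l False] z by (simp add: sphere_action_eq P w Let_def field_simps)
      next
        assume "u * v = 1"
        then have "(w * z) ^ N = 1"
          by (simp add: u_def v_def power_mult_distrib mult.commute)
        then obtain l where "l \<in> {0..<int N}" "w * z = omega (cover_index N) powi (2 * l)"
          using root_of_unity_eq_omega_power[OF assms(1)] by blast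
        then show ?thesis
          using mem[of l True] z by (simp add: sphere_action_eq P w Let_def flip: \<open>w * z = _\<close>)
      qed
    qed
  qed
qed (rule assms(4))

section \<open>The action on matrices in terms of roots of unity\<close>

lemma mat22_nth [simp]:
  "mat22 a b c d $ 1 $ 1 = a" "mat22 a b c d $ 1 $ 2 = b"
  "mat22 a b c d $ 2 $ 1 = c" "mat22 a b c d $ 2 $ 2 = d"
  by (simp_all add: mat22_def)

lemma mat22_eq_iff: "A = B \<longleftrightarrow> A $ 1 $ 1 = B $ 1 $ 1 \<and> A $ 1 $ 2 = B $ 1 $ 2 \<and> A $ 2 $ 1 = B $ 2 $ 1 \<and>
    A $ 2 $ 2 = (B $ 2 $ 2 :: 'a)" for A B :: "'a^2^2"
  by (auto simp: vec_eq_iff forall_2)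

lemma matrix_mult_22_nth [simp]:
  "(A ** B) $ i $ k = A $ i $ 1 * B $ 1 $ k + A $ i $ 2 * B $ 2 $ k" for A B :: "'a::semiring_1^2^2"
  by (simp add: matrix_matrix_mult_def sum_2)

lemma matrix_inv_eqI:
  fixes A B :: "'a::field^'n^'n"
  assumes "A ** B = mat 1"
  shows "matrix_inv A = B"
proof -
  have "B ** A = mat 1"
    using assms matrix_left_right_inverse by blast
  then have "A ** matrix_inv A = mat 1"
    using assms unfolding matrix_inv_def by (metis (mono_tags, lifting) someI_ex)
  then show ?thesis
    using \<open>B ** A = mat 1\<close> by (metis matrix_mul_assoc matrix_mul_lid matrix_mul_rid)
qed

lemma inv_dihedral:
  assumes "M > 0" "(l, b) \<in> carrier (dihedral M)"
  shows "inv\<^bsub>dihedral M\<^esub> (l, b) = (if b then (l, b) else ((- l) mod int M, b))"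
proof -
  interpret group "dihedral M" by (rule group_dihedral[OF assms(1)])
  show ?thesis
    by (rule inv_equality) (use assms in \<open>auto simp: dihedral_def mod_simps\<close>)
qed

lemma omega_powi_mod: "M > 0 \<Longrightarrow> omega M powi (l mod int M) = omega M powi l"
  by (rule omega_powi_cong) (simp_all flip: mod_eq_dvd_iff)

lemma omega_powi_double: "omega M powi (2 * l) = omega M powi l * omega M powi l"
  using power_int_add[of "omega M" l l] omega_nonzero by (simp only: mult_2) simp

text \<open>Conjugation by the diagonal matrix scales the off-diagonal entries by the square of
  \<omega>^(jl) or its inverse. Hence only \<open>c\<close>, an N-th root of unity when
  \<open>M = cover_index N\<close>, enters, although the matrices represent the larger covering
  group.\<close>

lemma mero_mat_action_rotation:
  fixes f :: "mero^2^2"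
  assumes "M > 0" "l \<in> {0..<int M}"
  defines "c \<equiv> inverse (omega M powi (2 * l))"
  defines "h \<equiv> const_mero c * lam"
  shows "mero_mat_action M j (l, False) f =
    mat22 (mero_comp (f $ 1 $ 1) h) (mero_comp (f $ 1 $ 2) h / const_mero c ^ j)
      (const_mero c ^ j * mero_comp (f $ 2 $ 1) h) (mero_comp (f $ 2 $ 2) h)"
proof -
  define w where "w = omega M powi l"
  have w: "w \<noteq> 0" by (simp add: w_def omega_nonzero)
  have c: "c = inverse (w * w)"
    by (simp add: c_def w_def omega_powi_double)
  have psi: "psi_rep M j (l, False) = mat22 (w ^ j) 0 0 (inverse (w ^ j))"
    using omega_nonzero[of M]
    by (simp add: psi_rep_eq w_def power_int_mult power_int_minus Let_def mult.commute[of "int j"])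
  have "inv\<^bsub>dihedral M\<^esub> (l, False) = ((- l) mod int M, False)"
    using assms(1,2) by (subst inv_dihedral) (auto simp: dihedral_def)
  then have "psi_rep M 1 (inv\<^bsub>dihedral M\<^esub> (l, False)) = mat22 (inverse w) 0 0 w"
    using omega_powi_mod[OF assms(1), of "- l"]
    by (simp add: psi_rep_eq w_def power_int_minus Let_def)
  then have h: "moebius (psi_rep M 1 (inv\<^bsub>dihedral M\<^esub> (l, False))) = h"
    using w by (simp add: moebius_def h_def c field_simps)
  have inv: "matrix_inv (psi_rep M j (l, False)) = mat22 (inverse (w ^ j)) 0 0 (w ^ j)"
    unfolding psi using w by (intro matrix_inv_eqI) (simp add: mat22_eq_iff mat_def)
  show ?thesis
    unfolding mero_mat_action_def h inv unfolding psi using w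
    by (simp add: mat22_eq_iff c power_mult_distrib power_inverse field_simps)
qed

lemma mero_mat_action_reflection:
  fixes f :: "mero^2^2"
  assumes "M > 0" "l \<in> {0..<int M}"
  defines "c \<equiv> omega M powi (2 * l)"
  defines "h \<equiv> const_mero c / lam"
  shows "mero_mat_action M j (l, True) f =
    mat22 (mero_comp (f $ 2 $ 2) h) (const_mero c ^ j * mero_comp (f $ 2 $ 1) h)
      (mero_comp (f $ 1 $ 2) h / const_mero c ^ j) (mero_comp (f $ 1 $ 1) h)"
proof -
  define w where "w = omega M powi l"
  have w: "w \<noteq> 0" by (simp add: w_def omega_nonzero)
  have c: "c = w * w"
    by (simp add: c_def w_def omega_powi_double)
  have psi: "psi_rep M j (l, True) = mat22 0 (w ^ j) (inverse (w ^ j)) 0" for j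
    using omega_nonzero[of M]
    by (simp add: psi_rep_eq w_def power_int_mult power_int_minus Let_def mult.commute[of "int j"])
  have "inv\<^bsub>dihedral M\<^esub> (l, True) = (l, True)"
    using assms(1,2) by (subst inv_dihedral) (auto simp: dihedral_def)
  then have h: "moebius (psi_rep M 1 (inv\<^bsub>dihedral M\<^esub> (l, True))) = h"
    using w by (simp add: psi moebius_def h_def c field_simps)
  have inv: "matrix_inv (psi_rep M j (l, True)) = psi_rep M j (l, True)"
    unfolding psi using w by (intro matrix_inv_eqI) (simp add: mat22_eq_iff mat_def)
  show ?thesis
    unfolding mero_mat_action_def h inv unfolding psi using w
    by (simp add: mat22_eq_iff c power_mult_distrib power_inverse field_simps)
qed

lemma invariant_iff:
  fixes f :: "mero^2^2"
  assumes "N > 0"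
  shows "(\<forall>g \<in> carrier (dihedral (cover_index N)). mero_mat_action (cover_index N) j g f = f) \<longleftrightarrow>
    (\<forall>c. c ^ N = 1 \<longrightarrow>
      f = mat22 (mero_comp (f $ 1 $ 1) (const_mero c * lam))
            (mero_comp (f $ 1 $ 2) (const_mero c * lam) / const_mero c ^ j)
            (const_mero c ^ j * mero_comp (f $ 2 $ 1) (const_mero c * lam))
            (mero_comp (f $ 2 $ 2) (const_mero c * lam)) \<and>
      f = mat22 (mero_comp (f $ 2 $ 2) (const_mero c / lam))
            (const_mero c ^ j * mero_comp (f $ 2 $ 1) (const_mero c / lam))
            (mero_comp (f $ 1 $ 2) (const_mero c / lam) / const_mero c ^ j)
            (mero_comp (f $ 1 $ 1) (const_mero c / lam)))"
    (is "?L \<longleftrightarrow> (\<forall>c. _ \<longrightarrow> f = ?rot c \<and> f = ?refl c)")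
proof
  have M: "cover_index N > 0" "N \<le> cover_index N"
    using assms by (auto simp: cover_index_def)
  note action = mero_mat_action_rotation[OF M(1)] mero_mat_action_reflection[OF M(1)]
  show ?L if R: "\<forall>c. c ^ N = 1 \<longrightarrow> f = ?rot c \<and> f = ?refl c"
  proof
    fix g assume g: "g \<in> carrier (dihedral (cover_index N))"
    obtain l b where lb: "g = (l, b)" "l \<in> {0..<int (cover_index N)}"
      using g by (cases g) (auto simp: dihedral_def)
    let ?c = "omega (cover_index N) powi (2 * l)"
    have "?c ^ N = 1" "inverse ?c ^ N = 1"
      using omega_power_N[OF assms] by (simp_all add: power_inverse)
    then show "mero_mat_action (cover_index N) j g f = f"
      using R action[OF lb(2), of j f] by (cases b) (auto simp only: lb(1))
  qed
  assume L: ?L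
  show "\<forall>c. c ^ N = 1 \<longrightarrow> f = ?rot c \<and> f = ?refl c"
  proof (intro allI impI conjI)
    fix c :: complex assume c: "c ^ N = 1"
    \<comment> \<open>The rotation with index \<open>l\<close> substitutes the inverse of
      \<omega>^(2l), so the index is taken from \<open>inverse c\<close>; the reflection further on
      uses \<open>c\<close> itself.\<close>
    then have "inverse c ^ N = 1" by (simp add: power_inverse)
    then obtain l where l: "l \<in> {0..<int N}" "inverse c = omega (cover_index N) powi (2 * l)"
      using root_of_unity_eq_omega_power[OF assms] by blast
    then have "c = inverse (omega (cover_index N) powi (2 * l))"
      by (metis inverse_inverse_eq)
    moreover have "l \<in> {0..<int (cover_index N)}"
      using l M by auto
    ultimately show "f = ?rot c"
      using L action(1)[of l j f] by (auto simp: dihedral_def)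
    from c obtain l where l: "l \<in> {0..<int N}" "c = omega (cover_index N) powi (2 * l)"
      using root_of_unity_eq_omega_power[OF assms] by blast
    moreover from l have "l \<in> {0..<int (cover_index N)}"
      using M by auto
    ultimately show "f = ?refl c"
      using L action(2)[of l j f] by (auto simp: dihedral_def)
  qed
qed

section \<open>Invariant matrices\<close>

text \<open>With \<open>\<lambda>\<^sup>j\<close> split off the entries outside the diagonal, the action of the group on \<open>\<alpha>\<close>, \<open>\<beta>\<close>, \<open>\<gamma>\<close> does
  not depend on \<open>j\<close>.\<close>

definition frame :: "nat \<Rightarrow> mero \<Rightarrow> mero \<Rightarrow> mero \<Rightarrow> mero^2^2" where
  "frame j \<alpha> \<beta> \<gamma> = mat22 \<alpha> (lam ^ j * \<beta>) (\<gamma> / lam ^ j) (- \<alpha>)"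

lemma frame_eq_iff: "frame j \<alpha> \<beta> \<gamma> = frame j \<alpha>' \<beta>' \<gamma>' \<longleftrightarrow> \<alpha> = \<alpha>' \<and> \<beta> = \<beta>' \<and> \<gamma> = \<gamma>'"
  by (auto simp: frame_def mat22_eq_iff)

lemma frame_zero: "frame j 0 0 0 = 0"
  by (simp add: frame_def mat22_eq_iff)

lemma frame_add: "frame j \<alpha> \<beta> \<gamma> + frame j \<alpha>' \<beta>' \<gamma>' = frame j (\<alpha> + \<alpha>') (\<beta> + \<beta>') (\<gamma> + \<gamma>')"
  by (simp add: frame_def mat22_eq_iff ring_distribs add_divide_distrib)

lemma mscale_frame: "a *\<^sub>M frame j \<alpha> \<beta> \<gamma> = frame j (a * \<alpha>) (a * \<beta>) (a * \<gamma>)"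
  by (simp add: frame_def mscale_def mat22_eq_iff)

lemma bracket_frame:
  "bracket (frame j \<alpha> \<beta> \<gamma>) (frame j \<alpha>' \<beta>' \<gamma>') =
    frame j (\<beta> * \<gamma>' - \<beta>' * \<gamma>) (2 * (\<alpha> * \<beta>' - \<alpha>' * \<beta>)) (2 * (\<gamma> * \<alpha>' - \<gamma>' * \<alpha>))"
  by (simp add: bracket_def frame_def mat22_eq_iff field_simps)

text \<open>The sign at \<open>\<alpha>\<close> and the exchange of \<open>\<beta>\<close> and
  \<open>\<gamma>\<close> come from conjugation by the swap matrix.\<close>

definition equivariant :: "nat \<Rightarrow> mero \<Rightarrow> mero \<Rightarrow> mero \<Rightarrow> bool" where
  "equivariant N \<alpha> \<beta> \<gamma> \<longleftrightarrow> (\<forall>c. c ^ N = 1 \<longrightarrow>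
     mero_comp \<alpha> (const_mero c * lam) = \<alpha> \<and> mero_comp \<beta> (const_mero c * lam) = \<beta> \<and>
     mero_comp \<gamma> (const_mero c * lam) = \<gamma> \<and> mero_comp \<alpha> (const_mero c / lam) = - \<alpha> \<and>
     mero_comp \<beta> (const_mero c / lam) = \<gamma> \<and> mero_comp \<gamma> (const_mero c / lam) = \<beta>)"

context single_orbit
begin

lemma rotation_nonconst: "c ^ N = 1 \<Longrightarrow> const_mero c * lam \<notin> range const_mero"
  by (intro lam_multiple_nonconst root_of_unity_nonzero)

lemma reflection_nonconst: "c ^ N = 1 \<Longrightarrow> const_mero c / lam \<notin> range const_mero"
  by (intro lam_inverse_multiple_nonconst root_of_unity_nonzero)


lemma invariant_frame_iff:
  "(\<forall>g \<in> carrier (dihedral (cover_index N)).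
      mero_mat_action (cover_index N) j g (frame j \<alpha> \<beta> \<gamma>) = frame j \<alpha> \<beta> \<gamma>) \<longleftrightarrow> equivariant N \<alpha> \<beta> \<gamma>"
  unfolding invariant_iff[OF N_pos] equivariant_def
proof (intro all_cong1 imp_cong refl, goal_cases)
  case (1 c)
  then have c0: "const_mero c \<noteq> 0"
    using root_of_unity_nonzero by simp
  have rot: "mero_comp (lam ^ j) (const_mero c * lam) = const_mero c ^ j * lam ^ j"
    using rotation_nonconst[OF 1] by (simp add: mero_comp_hom power_mult_distrib)
  have refl: "mero_comp (lam ^ j) (const_mero c / lam) = const_mero c ^ j / lam ^ j"
    using reflection_nonconst[OF 1] by (simp add: mero_comp_hom power_divide)
  let ?h = "const_mero c * lam" and ?k = "const_mero c / lam"
  have "frame j \<alpha> \<beta> \<gamma> = mat22 (mero_comp \<alpha> ?h) (mero_comp (lam ^ j * \<beta>) ?h / const_mero c ^ j)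
      (const_mero c ^ j * mero_comp (\<gamma> / lam ^ j) ?h) (mero_comp (- \<alpha>) ?h) \<longleftrightarrow>
    mero_comp \<alpha> ?h = \<alpha> \<and> mero_comp \<beta> ?h = \<beta> \<and> mero_comp \<gamma> ?h = \<gamma>"
    using c0 rotation_nonconst[OF 1]
    by (auto simp: mat22_eq_iff frame_def mero_comp_mult mero_comp_divide mero_comp_minus rot)
  moreover have "frame j \<alpha> \<beta> \<gamma> = mat22 (mero_comp (- \<alpha>) ?k) (const_mero c ^ j * mero_comp (\<gamma> / lam ^ j) ?k)
      (mero_comp (lam ^ j * \<beta>) ?k / const_mero c ^ j) (mero_comp \<alpha> ?k) \<longleftrightarrow>
    mero_comp \<alpha> ?k = - \<alpha> \<and> mero_comp \<beta> ?k = \<gamma> \<and> mero_comp \<gamma> ?k = \<beta>"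
    using c0 reflection_nonconst[OF 1]
    by (auto simp: mat22_eq_iff frame_def mero_comp_mult mero_comp_divide mero_comp_minus refl)
  ultimately show ?case
    by (auto simp: frame_def)
qed

lemma automorphic_lie_algebra_frame_iff:
  "frame j \<alpha> \<beta> \<gamma> \<in> automorphic_lie_algebra N j (zero_set (form_orbit N c1 c2)) \<longleftrightarrow>
    \<alpha> \<in> S \<and> lam ^ j * \<beta> \<in> S \<and> \<gamma> / lam ^ j \<in> S \<and> equivariant N \<alpha> \<beta> \<gamma>"
proof -
  have "trace (frame j \<alpha> \<beta> \<gamma>) = 0"
    by (simp add: trace_def sum_2 frame_def)
  moreover have "(\<forall>a b. frame j \<alpha> \<beta> \<gamma> $ a $ b \<in> S) \<longleftrightarrow> \<alpha> \<in> S \<and> lam ^ j * \<beta> \<in> S \<and> \<gamma> / lam ^ j \<in> S"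
    using S_minus[of \<alpha>] by (auto simp: forall_2 frame_def)
  ultimately show ?thesis
    by (simp add: automorphic_lie_algebra_def invariant_frame_iff S_iff_analytic) blast
qed

lemma automorphic_lie_algebra_frameE:
  assumes "f \<in> automorphic_lie_algebra N j \<Gamma>"
  obtains \<alpha> \<beta> \<gamma> where "f = frame j \<alpha> \<beta> \<gamma>"
proof
  have "f $ 2 $ 2 = - f $ 1 $ 1"
    using assms by (simp add: automorphic_lie_algebra_def trace_def sum_2 eq_neg_iff_add_eq_0 add.commute)
  then show "f = frame j (f $ 1 $ 1) (f $ 1 $ 2 / lam ^ j) (lam ^ j * f $ 2 $ 1)"
    by (simp add: frame_def mat22_eq_iff)
qed

text \<open>By invariance only powers \<open>\<lambda>\<^sup>i\<close> with \<open>i \<equiv> j\<close> modulo \<open>N\<close> occur in the numerator of \<open>\<lambda>\<^sup>j \<beta>\<close>.\<close>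

lemma shift_in_S:
  assumes "0 < j" "j < N" "lam ^ j * \<beta> \<in> S" "rotation_invariant \<beta>"
  shows "\<beta> \<in> S" "lam ^ N * \<beta> \<in> S"
proof -
  obtain p m where p: "lam ^ j * \<beta> = to_fract p / F ^ m" "degree p \<le> 2 * N * m"
    using assms(3) by (auto simp: S_def)
  define \<zeta> where "\<zeta> = omega (cover_index N) powi 2"
  have \<zeta>: "\<zeta> ^ N = 1"
    using omega_power_N[OF N_pos, of 1] by (simp add: \<zeta>_def)
  have \<zeta>0: "\<zeta> \<noteq> 0"
    using \<zeta> by (rule root_of_unity_nonzero)
  have "mero_comp (lam ^ j * \<beta>) (const_mero \<zeta> * lam) = const_mero (\<zeta> ^ j) * (lam ^ j * \<beta>)"
    using assms(4) \<zeta> rotation_nonconst[OF \<zeta>]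
    by (simp add: rotation_invariant_def mero_comp_mult mero_comp_power mero_comp_lam power_mult_distrib)
  then have "pcompose p [:0, \<zeta>:] = smult (\<zeta> ^ j) p"
    unfolding p(1) by (rule rotation_eigen[OF \<zeta>])
  then have coeff: "\<zeta> ^ i * poly.coeff p i = \<zeta> ^ j * poly.coeff p i" for i
    by (metis coeff_pcompose_linear coeff_smult)
  have cong: "int N dvd int i - int j" if "poly.coeff p i \<noteq> 0" for i
  proof -
    have "\<zeta> ^ i = \<zeta> ^ j"
      using coeff[of i] that by simp
    then have "\<zeta> powi (int i - int j) = 1"
      using \<zeta>0 by (simp add: power_int_diff)
    then have "omega (cover_index N) powi (2 * (int i - int j)) = 1"
      unfolding \<zeta>_def by (simp only: power_int_mult)
    then have "int (cover_index N) dvd 2 * (int i - int j)"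
      using N_pos by (subst (asm) omega_powi_eq_1_iff) (auto simp: cover_index_def)
    then show ?thesis
      using cover2[OF N_pos] by blast
  qed
  \<comment> \<open>No i < j is congruent to j modulo N, because j < N; so \<lambda>^j divides the
    numerator.\<close>
  have low: "poly.coeff p i = 0" if "i < j" for i
  proof (rule ccontr)
    assume "poly.coeff p i \<noteq> 0"
    from cong[OF this] have "int N dvd int j - int i"
      by (simp add: dvd_diff_commute)
    then have "int N \<le> int j - int i"
      using that by (intro zdvd_imp_le) auto
    then show False using assms(2) by simp
  qed
  then have "monom 1 j dvd p"
    by (simp add: monom_1_dvd_iff')
  then obtain r where r: "p = monom 1 j * r" by blast
  have \<beta>: "\<beta> = to_fract r / F ^ m"
  proof -
    have "lam ^ j * \<beta> = lam ^ j * (to_fract r / F ^ m)"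
      by (simp add: p(1) r to_fract_monom)
    then show ?thesis by (simp only: mult_cancel_left) simp
  qed
  have deg: "degree r + N \<le> 2 * N * m" if "r \<noteq> 0"
  proof -
    have dp: "degree p = j + degree r"
      using that by (simp add: r degree_mult_eq degree_monom_eq)
    have "poly.coeff p (degree p) \<noteq> 0"
      using that by (simp add: r)
    from cong[OF this] obtain k where "int (degree r) = int N * k"
      by (auto simp: dp dvd_def)
    moreover from this have "k \<ge> 0"
      using N_pos by (metis int_nat_eq of_nat_0_le_iff of_nat_0_less_iff zero_le_mult_iff leD)
    ultimately have k: "degree r = N * nat k"
      by (metis nat_int of_nat_mult int_nat_eq nat_0_le)
    \<comment> \<open>Strict because j > 0. A multiple of N below 2Nm is at most 2Nm - N, and this
      gap of N is the room for multiplying \<beta> by \<lambda>^N.\<close>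
    have "N * nat k < 2 * N * m"
      using dp p(2) k assms(1) by linarith
    then have "N * nat k < N * (2 * m)"
      by (simp only: ac_simps)
    then have "nat k + 1 \<le> 2 * m" by simp
    then have "N * (nat k + 1) \<le> N * (2 * m)"
      by (rule mult_le_mono2)
    then show ?thesis by (simp add: k)
  qed
  show "\<beta> \<in> S"
    using deg by (cases "r = 0") (auto intro!: S_I[OF \<beta>])
  show "lam ^ N * \<beta> \<in> S"
  proof (rule S_I)
    show "lam ^ N * \<beta> = to_fract (monom 1 N * r) / F ^ m"
      by (simp add: \<beta> to_fract_monom)
    show "degree (monom 1 N * r) \<le> 2 * N * m"
      using deg by (cases "r = 0") (auto simp: degree_mult_eq degree_monom_eq)
  qed
qed

end

section \<open>The generators\<close>

context
  fixes y a b F s :: "'a::field"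
  assumes F: "F = a * (y + 1)\<^sup>2 + b * (2 * y + 1)" and s: "s = a * ((y + 1) * y) / F"
    and nz: "F \<noteq> 0" "2 * y + 1 \<noteq> 0"
begin

text \<open>Here \<open>y\<close> stands for F_0 at Y = 1; then F_1 is \<open>y + 1\<close> and
  F_2^N is \<open>2 * y + 1\<close>, so all identities are rational in one variable.\<close>

lemma one_minus_s: "1 - s = (b * (2 * y + 1) + a * (y + 1)) / F"
proof -
  have "F - a * ((y + 1) * y) = b * (2 * y + 1) + a * (y + 1)"
    by (simp add: F power2_eq_square algebra_simps)
  moreover have "1 - s = (F - a * ((y + 1) * y)) / F"
    using nz by (simp add: s diff_divide_distrib)
  ultimately show ?thesis by simp
qed

lemma one_plus_s: "1 + s = (b + a * (y + 1)) * (2 * y + 1) / F"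
proof -
  have "F + a * ((y + 1) * y) = (b + a * (y + 1)) * (2 * y + 1)"
    by (simp add: F power2_eq_square algebra_simps)
  moreover have "1 + s = (F + a * ((y + 1) * y)) / F"
    using nz by (simp add: s add_divide_distrib)
  ultimately show ?thesis by simp
qed

text \<open>This and the next two identities show where the long entries of e_- come from: they are
  1 - s^2, (1 - s)^2 and (1 + s)^2 times F / F_2^N. In particular, the denominator F_2^N cancels on
  the diagonal.\<close>

lemma minus_entry_diagonal: "(1 - s\<^sup>2) * F / (2 * y + 1) = a + b + a * b * (y\<^sup>2 / F)"
proof -
  have "(1 - s\<^sup>2) * F / (2 * y + 1) = (1 - s) * (1 + s) * F / (2 * y + 1)"
    by (simp add: power2_eq_square algebra_simps)
  also have "\<dots> = (b * (2 * y + 1) + a * (y + 1)) * (b + a * (y + 1)) / F"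
    using nz unfolding one_minus_s one_plus_s by simp
  also have "(b * (2 * y + 1) + a * (y + 1)) * (b + a * (y + 1)) = (a + b) * F + a * b * y\<^sup>2"
    by (simp add: F power2_eq_square algebra_simps)
  finally show ?thesis
    using nz by (simp add: add_divide_distrib)
qed

lemma minus_entry_upper:
  "(1 - s)\<^sup>2 * F / (2 * y + 1) = b * (a + b) * ((2 * y + 1) / F) + a / (2 * y + 1)"
proof -
  have "(b * (2 * y + 1) + a * (y + 1))\<^sup>2 = b * (a + b) * (2 * y + 1)\<^sup>2 + a * F"
    by (simp add: F power2_eq_square algebra_simps)
  moreover have "(1 - s)\<^sup>2 * F / (2 * y + 1) = (b * (2 * y + 1) + a * (y + 1))\<^sup>2 / (F * (2 * y + 1))"
    using nz unfolding one_minus_s by (simp add: power2_eq_square)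
  moreover define u where "u = 2 * y + 1"
  ultimately show ?thesis
    using nz unfolding u_def[symmetric] by (simp add: add_divide_distrib power2_eq_square)
qed

lemma minus_entry_lower:
  "(1 + s)\<^sup>2 * F / (2 * y + 1) = b * (a + b) * ((2 * y + 1) / F) + a * (2 * y + 1)"
proof -
  have "(b + a * (y + 1))\<^sup>2 * (2 * y + 1) = (b * (a + b) + a * F) * (2 * y + 1)"
    by (simp add: F power2_eq_square algebra_simps)
  moreover have "(1 + s)\<^sup>2 * F / (2 * y + 1) = (b + a * (y + 1))\<^sup>2 * (2 * y + 1) / F"
    using nz unfolding one_plus_s by (simp add: power2_eq_square)
  moreover define u where "u = 2 * y + 1"
  ultimately show ?thesis
    using nz unfolding u_def[symmetric] by (simp add: add_divide_distrib distrib_right)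
qed

end

lemma equivariant_add:
  assumes "N > 0" "equivariant N \<alpha> \<beta> \<gamma>" "equivariant N \<alpha>' \<beta>' \<gamma>'"
  shows "equivariant N (\<alpha> + \<alpha>') (\<beta> + \<beta>') (\<gamma> + \<gamma>')"
  unfolding equivariant_def
proof (intro allI impI)
  fix c :: complex assume c: "c ^ N = 1"
  \<comment> \<open>Any admissible pair of coefficients would do: the facts taken from the locale
    concern N-th roots of unity.\<close>
  interpret single_orbit N 1 0 by unfold_locales (use assms(1) in auto)
  show "mero_comp (\<alpha> + \<alpha>') (const_mero c * lam) = \<alpha> + \<alpha>' \<and>
      mero_comp (\<beta> + \<beta>') (const_mero c * lam) = \<beta> + \<beta>' \<and>
      mero_comp (\<gamma> + \<gamma>') (const_mero c * lam) = \<gamma> + \<gamma>' \<and>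
      mero_comp (\<alpha> + \<alpha>') (const_mero c / lam) = - (\<alpha> + \<alpha>') \<and>
      mero_comp (\<beta> + \<beta>') (const_mero c / lam) = \<gamma> + \<gamma>' \<and>
      mero_comp (\<gamma> + \<gamma>') (const_mero c / lam) = \<beta> + \<beta>'"
    using assms(2,3) c by (simp add: equivariant_def mero_comp_add rotation_nonconst reflection_nonconst)
qed

lemma equivariant_scale:
  assumes "N > 0" "equivariant N \<alpha> \<beta> \<gamma>"
    and "\<And>c. c ^ N = 1 \<Longrightarrow> mero_comp a (const_mero c * lam) = a"
    and "\<And>c. c ^ N = 1 \<Longrightarrow> mero_comp a (const_mero c / lam) = a"
  shows "equivariant N (a * \<alpha>) (a * \<beta>) (a * \<gamma>)"
  unfolding equivariant_def
proof (intro allI impI)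
  fix c :: complex assume c: "c ^ N = 1"
  interpret single_orbit N 1 0 by unfold_locales (use assms(1) in auto)
  show "mero_comp (a * \<alpha>) (const_mero c * lam) = a * \<alpha> \<and>
      mero_comp (a * \<beta>) (const_mero c * lam) = a * \<beta> \<and>
      mero_comp (a * \<gamma>) (const_mero c * lam) = a * \<gamma> \<and>
      mero_comp (a * \<alpha>) (const_mero c / lam) = - (a * \<alpha>) \<and>
      mero_comp (a * \<beta>) (const_mero c / lam) = a * \<gamma> \<and>
      mero_comp (a * \<gamma>) (const_mero c / lam) = a * \<beta>"
    using assms(2-4) c by (simp add: equivariant_def mero_comp_mult rotation_nonconst reflection_nonconst)
qed

context single_orbit
begin

abbreviation "X \<equiv> (lam ^ N + 1) / 2"
abbreviation "Y \<equiv> (lam ^ N - 1) / 2"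

text \<open>With the powers of \<lambda>^j split off, e_0 has the entries s, 1 - s, 1 + s, -s. So
  e_0 squares to 1, and the nilpotent e_+ and e_- are root vectors for it, scaled by
  \<open>G\<close> and \<open>H\<close>. All three functions change sign under \<lambda> \<mapsto>
  1/\<lambda>.\<close>

definition s :: mero where "s = const_mero c1 * (X * Y) / F"
definition G :: mero where "G = Y * X * lam ^ N / (2 * F\<^sup>2)"
definition H :: mero where "H = Y * X / (2 * F)"

lemma lam_power_N: "2 * Y + 1 = lam ^ N" "Y + 1 = X"
  by (simp_all add: field_simps)

lemma F_Y: "F = const_mero c1 * (Y + 1)\<^sup>2 + const_mero c2 * (2 * Y + 1)"
  unfolding lam_power_N by (rule form_orbit_mero_eq)

lemma s_Y: "s = const_mero c1 * ((Y + 1) * Y) / F"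
  unfolding lam_power_N by (rule s_def)

lemma Y_nonzero: "2 * Y + 1 \<noteq> 0"
  unfolding lam_power_N by simp

lemmas s_identities = one_minus_s[OF F_Y s_Y F_nonzero Y_nonzero, unfolded lam_power_N]
  one_plus_s[OF F_Y s_Y F_nonzero Y_nonzero, unfolded lam_power_N]
  minus_entry_diagonal[OF F_Y s_Y F_nonzero Y_nonzero, unfolded lam_power_N]
  minus_entry_upper[OF F_Y s_Y F_nonzero Y_nonzero, unfolded lam_power_N]
  minus_entry_lower[OF F_Y s_Y F_nonzero Y_nonzero, unfolded lam_power_N]

lemma X_Y_nonzero: "X \<noteq> 0" "Y \<noteq> 0"
proof -
  have "lam ^ N \<noteq> const_mero c" for c
  proof -
    have "monom 1 N \<noteq> [:c:]"
      using N_pos by (metis degree_monom_eq degree_pCons_0 less_irrefl zero_neq_one)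
    then have "to_fract (monom 1 N) \<noteq> to_fract [:c:]"
      by (simp only: to_fract_eq_iff not_False_eq_True)
    then show ?thesis
      unfolding to_fract_monom const_mero_def[of c, symmetric] by simp
  qed
  from this[of 1] this[of "- 1"] show "X \<noteq> 0" "Y \<noteq> 0"
    by (auto simp: eq_neg_iff_add_eq_0)
qed

lemma G_nonzero: "G \<noteq> 0" and H_nonzero: "H \<noteq> 0"
  using X_Y_nonzero F_nonzero by (simp_all add: G_def H_def)

lemma G_eq: "G = H * (lam ^ N / F)"
  by (simp add: G_def H_def power2_eq_square)

lemma form_mero_simps:
  "form_mero N 0 = Y" "form_mero N 1 = X" "form_mero N 2 = lam"
  by (simp_all add: form_def)

lemma lam_powi_simps:
  "lam powi int j = lam ^ j" "lam powi (- int j) = 1 / lam ^ j"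
  "lam powi (int j - int N) = lam ^ j / lam ^ N" "lam powi (int N - int j) = lam ^ N / lam ^ j"
  by (simp_all add: power_int_diff power_int_minus divide_inverse)

lemma e_zero_frame: "e_zero N j c1 c2 = frame j s (1 - s) (1 + s)"
proof -
  have upper: "u * (b * l + a / 2 * (l + l / u)) = l * (b * u + a * ((u + 1) / 2))"
    and lower: "u * (b * (1 / l) + a / 2 * (1 / l + u / l)) = (b + a * ((u + 1) / 2)) * u / l"
    if "u \<noteq> 0" "l \<noteq> 0" for u l a b :: mero
    using that by (simp_all add: field_simps)
  have nz: "lam ^ N \<noteq> 0" "lam ^ j \<noteq> 0" by simp_all
  show ?thesis
    unfolding e_zero_def Let_def form_mero_simps lam_powi_simps upper[OF nz] lower[OF nz] s_identities(1,2)
    by (simp add: frame_def mat22_eq_iff mscale_def s_def)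
qed

lemma e_plus_frame: "e_plus N j c1 c2 = frame j G (- G) G"
  unfolding e_plus_def Let_def form_mero_simps lam_powi_simps G_def[symmetric]
  by (simp add: frame_def mat22_eq_iff mscale_def)

lemma e_minus_frame: "e_minus N j c1 c2 = frame j (H * (1 - s\<^sup>2)) (H * (1 - s)\<^sup>2) (- (H * (1 + s)\<^sup>2))"
proof -
  have GH: "H * z = G * (z * F / lam ^ N)" for z
    using F_nonzero by (simp add: G_eq)
  show ?thesis
    unfolding GH s_identities(3-5) e_minus_def Let_def form_mero_simps lam_powi_simps G_def[symmetric]
    by (simp add: frame_def mat22_eq_iff mscale_def) (simp flip: mult_minus_right)
qed

lemma prod_forms: "(\<Prod>i = 0..2. form_mero N i ^ nu N i / F) = 4 * (G * H)"
proof -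
  have alg: "y\<^sup>2 / z * (x\<^sup>2 / z * (u / z)) = 4 * (y * x * u / (2 * z\<^sup>2) * (y * x / (2 * z)))"
    for x y z u :: mero
    by (simp add: power2_eq_square ac_simps)
  have "{0..2} = {0, 1, 2 :: nat}" by auto
  then have "(\<Prod>i = 0..2. form_mero N i ^ nu N i / F) = Y\<^sup>2 / F * (X\<^sup>2 / F * (lam ^ N / F))"
    by (simp add: form_mero_simps[unfolded One_nat_def] nu_def del: times_divide_eq_left times_divide_eq_right)
  also have "\<dots> = 4 * (G * H)"
    unfolding G_def H_def by (rule alg)
  finally show ?thesis .
qed

lemma bracket_e_zero_e_plus: "bracket (e_zero N j c1 c2) (e_plus N j c1 c2) = 2 *\<^sub>M e_plus N j c1 c2"
  unfolding e_zero_frame e_plus_frame bracket_frame mscale_frame frame_eq_iff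
  by (simp add: algebra_simps)

lemma bracket_e_zero_e_minus: "bracket (e_zero N j c1 c2) (e_minus N j c1 c2) = (- 2) *\<^sub>M e_minus N j c1 c2"
  unfolding e_zero_frame e_minus_frame bracket_frame mscale_frame frame_eq_iff
  by (simp add: algebra_simps power2_eq_square)

lemma bracket_e_plus_e_minus:
  "bracket (e_plus N j c1 c2) (e_minus N j c1 c2) = (\<Prod>i = 0..2. form_mero N i ^ nu N i / F) *\<^sub>M e_zero N j c1 c2"
  unfolding e_zero_frame e_plus_frame e_minus_frame bracket_frame mscale_frame frame_eq_iff prod_forms
  by (simp add: algebra_simps power2_eq_square)

lemma combination_frame:
  "a *\<^sub>M e_zero N j c1 c2 + b *\<^sub>M e_plus N j c1 c2 + c *\<^sub>M e_minus N j c1 c2 =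
    frame j (a * s + b * G + c * H * (1 - s\<^sup>2)) (a * (1 - s) - b * G + c * H * (1 - s)\<^sup>2)
      (a * (1 + s) + b * G - c * H * (1 + s)\<^sup>2)"
  unfolding e_zero_frame e_plus_frame e_minus_frame mscale_frame frame_add frame_eq_iff
  by (simp add: mult.assoc)

lemma combination_eq_0:
  assumes "a *\<^sub>M e_zero N j c1 c2 + b *\<^sub>M e_plus N j c1 c2 + c *\<^sub>M e_minus N j c1 c2 = 0"
  shows "a = 0 \<and> b = 0 \<and> c = 0"
proof -
  have eqs: "a * s + b * G + c * H * (1 - s\<^sup>2) = 0" "a * (1 - s) - b * G + c * H * (1 - s)\<^sup>2 = 0"
      "a * (1 + s) + b * G - c * H * (1 + s)\<^sup>2 = 0"
    using assms unfolding combination_frame frame_zero[of j, symmetric] frame_eq_iff by auto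
  \<comment> \<open>Up to the factor G this is the trace pairing with e_+, which annihilates e_0 and
    e_+.\<close>
  have "4 * (c * H) = 2 * (a * s + b * G + c * H * (1 - s\<^sup>2)) + (a * (1 - s) - b * G + c * H * (1 - s)\<^sup>2) -
      (a * (1 + s) + b * G - c * H * (1 + s)\<^sup>2)"
    by (simp add: algebra_simps power2_eq_square)
  then have "4 * (c * H) = 0"
    unfolding eqs by simp
  then have c: "c = 0"
    using H_nonzero by simp
  have "a = (a * s + b * G) + (a * (1 - s) - b * G)"
    by (simp add: algebra_simps)
  also have "\<dots> = 0"
    using eqs(1,2) by (simp add: c)
  finally have "a = 0" .
  then show ?thesis
    using c eqs(1) G_nonzero by simp
qed

lemma S_lam: "i \<le> 2 * N \<Longrightarrow> lam ^ i / F \<in> S"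
  using S_frac[of "monom 1 i"] by (simp add: to_fract_monom degree_monom_eq)

lemmas S_intros = S_add S_diff S_minus S_mult S_const S_lam S_divide_numeral

lemma H_in_S: "H \<in> S"
proof -
  have "(u - 1) / 2 * ((u + 1) / 2) / (2 * z) = (u\<^sup>2 / z - 1 / z) / 8" for u z :: mero
    by (simp add: power2_eq_square algebra_simps flip: diff_divide_distrib)
  from this[of "lam ^ N" F] have H: "H = (lam ^ (2 * N) / F - lam ^ 0 / F) / 8"
    by (simp only: H_def power_even_eq power_0)
  show ?thesis
    unfolding H by (intro S_divide_numeral S_diff S_lam) auto
qed

lemma s_eq: "s = const_mero (2 * c1) * H"
proof -
  have "c * (x * y) / z = 2 * c * (y * x / (2 * z))" for c x y z :: mero
    by (simp add: ac_simps)
  then show ?thesis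
    unfolding s_def H_def const_mero_simps const_mero_numeral .
qed

lemma s_in_S: "s \<in> S"
  unfolding s_eq by (intro S_intros H_in_S)

lemma G_in_S: "G \<in> S"
  unfolding G_eq by (intro S_intros H_in_S) simp

lemma one_in_S: "1 \<in> S"
  using S_const[of 1] by simp

context
  fixes j :: nat
  assumes j: "0 < j" "j < N"
begin

text \<open>Each entry expands into terms with a factor \<lambda>^i / F, where i is one of j, j + N,
  N - j, 2N - j. Since 0 < j < N, all these exponents lie between 0 and 2N, so there are no poles at
  0 or infinity outside the zero set of F.\<close>

lemma shifted_entries_in_S:
  "lam ^ j * (1 - s) \<in> S" "(1 + s) / lam ^ j \<in> S" "lam ^ j * G \<in> S" "G / lam ^ j \<in> S"
proof -
  have diff: "lam ^ (N - j) = lam ^ N / lam ^ j" "lam ^ (2 * N - j) = lam ^ (2 * N) / lam ^ j"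
    using j by (simp_all add: power_diff)
  have upper: "lam ^ j * (1 - s) = const_mero (c2 + c1 / 2) * (lam ^ (j + N) / F) + const_mero (c1 / 2) * (lam ^ j / F)"
  proof -
    have "l * ((b * u + a * ((u + 1) / 2)) / z) = (b + a / 2) * (l * u / z) + a / 2 * (l / z)"
      for l u z a b :: mero
      by (simp add: algebra_simps add_divide_distrib)
    then show ?thesis by (simp add: s_identities power_add)
  qed
  show "lam ^ j * (1 - s) \<in> S"
    unfolding upper by (intro S_add S_mult S_const S_lam) (use j in auto)
  have lower: "(1 + s) / lam ^ j = const_mero (c2 + c1 / 2) * (lam ^ (N - j) / F) + const_mero (c1 / 2) * (lam ^ (2 * N - j) / F)"
  proof -
    have "(b + a * ((u + 1) / 2)) * u / z / l = (b + a / 2) * (u / l / z) + a / 2 * (u\<^sup>2 / l / z)"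
      for l u z a b :: mero
      by (simp add: algebra_simps add_divide_distrib power2_eq_square)
    then show ?thesis by (simp add: s_identities diff power_even_eq)
  qed
  show "(1 + s) / lam ^ j \<in> S"
    unfolding lower by (intro S_add S_mult S_const S_lam) (use j in auto)
  have upper: "lam ^ j * G = H * (lam ^ (j + N) / F)"
    by (simp add: G_eq power_add)
  show "lam ^ j * G \<in> S"
    unfolding upper by (intro S_mult S_lam H_in_S) (use j in auto)
  have lower: "G / lam ^ j = H * (lam ^ (N - j) / F)"
    by (simp add: G_eq diff)
  show "G / lam ^ j \<in> S"
    unfolding lower by (intro S_mult S_lam H_in_S) (use j in auto)
qed

end

lemma mero_comp_rotation:
  assumes "c ^ N = 1"
  shows "mero_comp (lam ^ N) (const_mero c * lam) = lam ^ N"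
    "mero_comp s (const_mero c * lam) = s" "mero_comp G (const_mero c * lam) = G"
    "mero_comp H (const_mero c * lam) = H"
proof -
  note h = mero_comp_hom[OF rotation_nonconst[OF assms]] mero_comp_orbit_rotation[OF assms N_pos]
  show u: "mero_comp (lam ^ N) (const_mero c * lam) = lam ^ N"
    using assms by (simp add: h power_mult_distrib flip: const_mero_power)
  then show "mero_comp s (const_mero c * lam) = s" "mero_comp G (const_mero c * lam) = G"
    "mero_comp H (const_mero c * lam) = H"
    by (simp_all add: s_def G_def H_def h)
qed

lemma mero_comp_reflection:
  assumes "c ^ N = 1"
  shows "mero_comp (lam ^ N) (const_mero c / lam) = 1 / lam ^ N"
    "mero_comp s (const_mero c / lam) = - s" "mero_comp G (const_mero c / lam) = - G"
    "mero_comp H (const_mero c / lam) = - H"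
proof -
  note h = mero_comp_hom[OF reflection_nonconst[OF assms]] mero_comp_orbit_reflection[OF assms N_pos]
  show u: "mero_comp (lam ^ N) (const_mero c / lam) = 1 / lam ^ N"
    using assms by (simp add: h power_divide flip: const_mero_power)
  then have u': "(const_mero c / lam) ^ N = 1 / lam ^ N"
    by (simp add: h)
  have XY: "mero_comp (Y * X) (const_mero c / lam) = - (Y * X) / (lam ^ N)\<^sup>2"
  proof -
    have "(1 / u - 1) / 2 * ((1 / u + 1) / 2) = - ((u - 1) / 2 * ((u + 1) / 2)) / u\<^sup>2" if "u \<noteq> 0" for u :: mero
      using that by (simp add: power2_eq_square field_simps)
    from this[of "lam ^ N"] show ?thesis by (simp add: h u')
  qed
  have F: "mero_comp F (const_mero c / lam) = F / (lam ^ N)\<^sup>2"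
    by (simp add: h power_even_eq)
  show H: "mero_comp H (const_mero c / lam) = - H"
    unfolding H_def mero_comp_divide[OF reflection_nonconst[OF assms]]
      mero_comp_mult[OF reflection_nonconst[OF assms], of 2] XY F
    by (simp add: h)
  show "mero_comp s (const_mero c / lam) = - s"
    using H by (simp add: s_eq h del: const_mero_simps)
  have "mero_comp (lam ^ N / F) (const_mero c / lam) = lam ^ N / F"
    using F u F_nonzero by (simp add: mero_comp_divide[OF reflection_nonconst[OF assms]] power2_eq_square)
  then show "mero_comp G (const_mero c / lam) = - G"
    unfolding G_eq mero_comp_mult[OF reflection_nonconst[OF assms]] H by simp
qed

lemma equivariant_generators:
  "equivariant N s (1 - s) (1 + s)" "equivariant N G (- G) G"
  "equivariant N (H * (1 - s\<^sup>2)) (H * (1 - s)\<^sup>2) (- (H * (1 + s)\<^sup>2))"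
  unfolding equivariant_def
  by (simp_all add: mero_comp_rotation mero_comp_reflection mero_comp_hom(3-) rotation_nonconst
      reflection_nonconst)

end

text \<open>The relation F_0^2 = F_1^2 - F_2^N brings \<open>k = 0\<close> into the pencil; the
  other two cases are its basis.\<close>

lemma form_power_eq_form_orbit:
  assumes "k \<in> {0, 1, 2}" "(d1, d2) = (if k = 0 then (1, - 1) else if k = 1 then (1, 0) else (0, 1))"
  shows "form_mero N k ^ nu N k = form_orbit_mero N d1 d2"
proof -
  have sq: "((x - 1) / 2)\<^sup>2 = ((x + 1) / 2)\<^sup>2 - x" for x :: mero
    by (simp add: power2_eq_square field_simps)
  consider "k = 0" | "k = 1" | "k = 2"
    using assms(1) by blast
  then show ?thesis
    by cases (use assms(2) sq[of "lam ^ N"] in \<open>simp_all add: form_orbit_def form_def nu_def\<close>)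
qed

context single_orbit
begin

context
  fixes j :: nat and d1 d2 :: complex
  assumes j: "0 < j" "j < N" and independent: "c1 * d2 \<noteq> c2 * d1"
begin

abbreviation "A \<equiv> automorphic_lie_algebra N j (zero_set (form_orbit N c1 c2))"
abbreviation "R \<equiv> adjoin (form_orbit_mero N d1 d2 / F)"

lemma A_add: "f \<in> A \<Longrightarrow> g \<in> A \<Longrightarrow> f + g \<in> A"
proof -
  assume f: "f \<in> A" and g: "g \<in> A"
  obtain \<alpha> \<beta> \<gamma> \<alpha>' \<beta>' \<gamma>' where eq: "f = frame j \<alpha> \<beta> \<gamma>" "g = frame j \<alpha>' \<beta>' \<gamma>'"
    using f g by (metis automorphic_lie_algebra_frameE)
  show "f + g \<in> A"
    using f g unfolding eq frame_add automorphic_lie_algebra_frame_iff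
    by (auto simp: distrib_left add_divide_distrib intro: S_add equivariant_add[OF N_pos])
qed

lemma A_scale: "a \<in> R \<Longrightarrow> f \<in> A \<Longrightarrow> a *\<^sub>M f \<in> A"
proof -
  assume a: "a \<in> R" and f: "f \<in> A"
  obtain \<alpha> \<beta> \<gamma> where eq: "f = frame j \<alpha> \<beta> \<gamma>"
    using f by (metis automorphic_lie_algebra_frameE)
  have "a * \<alpha> \<in> S" "a * (lam ^ j * \<beta>) \<in> S" "a * (\<gamma> / lam ^ j) \<in> S"
    using f adjoin_t_in_S[OF independent a] unfolding eq automorphic_lie_algebra_frame_iff
    by (auto intro: S_mult simp del: times_divide_eq_left times_divide_eq_right)
  moreover have "equivariant N (a * \<alpha>) (a * \<beta>) (a * \<gamma>)"
    using f adjoin_t_rotation[OF independent a] adjoin_t_reflection[OF independent a]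
    unfolding eq automorphic_lie_algebra_frame_iff by (intro equivariant_scale N_pos) auto
  ultimately show "a *\<^sub>M f \<in> A"
    unfolding eq mscale_frame automorphic_lie_algebra_frame_iff by (simp add: mult.left_commute)
qed

lemma generators_in_A: "e_zero N j c1 c2 \<in> A" "e_plus N j c1 c2 \<in> A" "e_minus N j c1 c2 \<in> A"
proof -
  note entries = shifted_entries_in_S[OF j]
  show "e_zero N j c1 c2 \<in> A"
    unfolding e_zero_frame automorphic_lie_algebra_frame_iff
    by (intro conjI s_in_S entries equivariant_generators)
  show "e_plus N j c1 c2 \<in> A"
    unfolding e_plus_frame automorphic_lie_algebra_frame_iff mult_minus_right
    by (intro conjI G_in_S S_minus entries equivariant_generators)
  have upper: "lam ^ j * (H * (1 - s)\<^sup>2) = H * (1 - s) * (lam ^ j * (1 - s))"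
    and lower: "- (H * (1 + s)\<^sup>2) / lam ^ j = - (H * (1 + s) * ((1 + s) / lam ^ j))"
    by (simp_all add: power2_eq_square ac_simps)
  show "e_minus N j c1 c2 \<in> A"
    unfolding e_minus_frame automorphic_lie_algebra_frame_iff upper lower power2_eq_square[of s]
    by (intro conjI equivariant_generators[unfolded power2_eq_square[of s]] S_mult S_minus S_diff S_add H_in_S s_in_S one_in_S entries)
qed

lemma combination_in_A:
  assumes "a \<in> R" "b \<in> R" "c \<in> R"
  shows "a *\<^sub>M e_zero N j c1 c2 + b *\<^sub>M e_plus N j c1 c2 + c *\<^sub>M e_minus N j c1 c2 \<in> A"
  using assms by (intro A_add A_scale generators_in_A)

text \<open>The coefficients are obtained from the trace form, for which \<open>e\<^sub>0\<close> is orthogonal to the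
  isotropic pair \<open>e\<^sub>+\<close>, \<open>e\<^sub>-\<close>.\<close>

lemma combination_if_in_A:
  assumes "f \<in> A"
  shows "\<exists>a b c. f = a *\<^sub>M e_zero N j c1 c2 + b *\<^sub>M e_plus N j c1 c2 + c *\<^sub>M e_minus N j c1 c2 \<and>
    a \<in> R \<and> b \<in> R \<and> c \<in> R"
proof -
  obtain \<alpha> \<beta> \<gamma> where f: "f = frame j \<alpha> \<beta> \<gamma>"
    using assms by (metis automorphic_lie_algebra_frameE)
  have S: "\<alpha> \<in> S" "lam ^ j * \<beta> \<in> S" and eqv: "equivariant N \<alpha> \<beta> \<gamma>"
    using assms unfolding f automorphic_lie_algebra_frame_iff by auto
  have rot: "mero_comp \<alpha> (const_mero c * lam) = \<alpha>" "mero_comp \<beta> (const_mero c * lam) = \<beta>"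
      "mero_comp \<gamma> (const_mero c * lam) = \<gamma>" if "c ^ N = 1" for c
    using eqv that by (auto simp: equivariant_def)
  have refl: "mero_comp \<alpha> (1 / lam) = - \<alpha>" "mero_comp \<beta> (1 / lam) = \<gamma>" "mero_comp \<gamma> (1 / lam) = \<beta>"
    using eqv[unfolded equivariant_def, rule_format, of 1] by auto
  have "rotation_invariant \<beta>"
    using rot by (simp add: rotation_invariant_def)
  then have \<beta>: "\<beta> \<in> S" "lam ^ N * \<beta> \<in> S"
    using shift_in_S[OF j S(2)] by auto
  \<comment> \<open>The reflection takes \<beta> to \<gamma> and \<lambda>^N \<beta> to \<gamma> /
    \<lambda>^N.\<close>
  have \<gamma>: "\<gamma> \<in> S" "\<gamma> / lam ^ N \<in> S"
    using S_reflection[OF \<beta>(1)] S_reflection[OF \<beta>(2)] mero_comp_reflection(1)[of 1] refl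
    by (simp_all add: mero_comp_mult inverse_lam_nonconst)
  note refl' = mero_comp_reflection[of 1, simplified] mero_comp_orbit_reflection[of 1 N, simplified, OF N_pos]
  note hom = mero_comp_hom[OF inverse_lam_nonconst]

  \<comment> \<open>Half the trace of f e_0, as the trace of e_0^2 is 2.\<close>
  define a where "a = \<alpha> * s + (\<beta> * (1 + s) + \<gamma> * (1 - s)) / 2"
  have "a \<in> R"
  proof (rule invariant_in_adjoin[OF independent])
    show "a \<in> S"
      unfolding a_def by (intro S_divide_numeral S_add S_diff S_mult S s_in_S \<beta> \<gamma> one_in_S)
    show "rotation_invariant a"
      unfolding rotation_invariant_def a_def
      by (simp add: mero_comp_hom rotation_nonconst rot mero_comp_rotation)
    show "mero_comp a (1 / lam) = a"
      by (simp add: a_def mero_comp_add mero_comp_mult mero_comp_divide mero_comp_diff mero_comp_1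
          mero_comp_numeral inverse_lam_nonconst refl refl' add.commute)
  qed

  \<comment> \<open>H = F_0 F_1 / (2F) is itself antiinvariant, so the quotient is invariant; its
    regularity is the divisibility of antiinvariant functions by F_0 F_1.\<close>
  have quotient: "w / (4 * H) \<in> R"
    if "w \<in> S" "rotation_invariant w" "mero_comp w (1 / lam) = - w" for w
  proof (rule invariant_in_adjoin[OF independent])
    have "w / (4 * H) = w * (F / (Y * X)) / 2"
    proof -
      have "w / (4 * (q / (2 * z))) = w * (z / q) / 2" for q z :: mero
        by (cases "q = 0") (simp_all add: field_simps)
      then show ?thesis
        unfolding H_def .
    qed
    then show "w / (4 * H) \<in> S"
      using antiinvariant_divisible[OF that] S_divide_numeral by (simp only: form_mero_simps)
    show "rotation_invariant (w / (4 * H))"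
      using that(2) by (simp add: rotation_invariant_def mero_comp_hom rotation_nonconst mero_comp_rotation)
    show "mero_comp (w / (4 * H)) (1 / lam) = w / (4 * H)"
      using that(3) by (simp add: hom refl')
  qed

  \<comment> \<open>The trace of f e_+ divided by G. On e_- it takes the value 4H, which explains
    the denominator of \<open>c\<close>.\<close>
  define w where "w = 2 * \<alpha> + \<beta> - \<gamma>"
  define c where "c = w / (4 * H)"
  have "c \<in> R"
    unfolding c_def
  proof (rule quotient)
    show "w \<in> S"
      unfolding w_def mult_2 by (intro S_add S_diff S \<beta> \<gamma>)
    show "rotation_invariant w"
      unfolding rotation_invariant_def w_def by (simp add: mero_comp_hom rotation_nonconst rot)
    show "mero_comp w (1 / lam) = - w"
      by (simp add: w_def hom refl)
  qed

  \<comment> \<open>The trace of f e_- divided by H. On e_+ it takes the value 4G, and 1/G is F /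
    (\<lambda>^N H).\<close>
  define v where "v = 2 * \<alpha> * (1 - s\<^sup>2) - \<beta> * (1 + s)\<^sup>2 + \<gamma> * (1 - s)\<^sup>2"
  define b where "b = v * (F / lam ^ N) / (4 * H)"
  have "b \<in> R"
    unfolding b_def
  proof (rule quotient)
    have "Y\<^sup>2 / F = form_orbit_mero N 1 (- 1) / F"
      using form_power_eq_form_orbit[of 0 1 "- 1" N] by (simp only: form_mero_simps nu_def if_True) simp
    then have YF: "Y\<^sup>2 / F \<in> S"
      using S_frac[OF degree_orbit_poly[of N 1 "- 1"]] by (simp only: to_fract_orbit_poly)
    have "(2 * \<alpha> * p - \<beta> * q + \<gamma> * r) * (z / u) = 2 * \<alpha> * (p * z / u) - \<beta> * (q * z / u) + \<gamma> * (r * z / u)"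
      for p q r z u
      by (simp add: algebra_simps add_divide_distrib diff_divide_distrib)
    then have "v * (F / lam ^ N) = 2 * \<alpha> * ((1 - s\<^sup>2) * F / lam ^ N) - \<beta> * ((1 + s)\<^sup>2 * F / lam ^ N) +
        \<gamma> * ((1 - s)\<^sup>2 * F / lam ^ N)"
      unfolding v_def .
    \<comment> \<open>The division by \<lambda>^N is carried out inside the squares of 1 - s and 1 +
      s. What remains of it are the terms \<lambda>^N \<beta> and \<gamma> / \<lambda>^N, both
      already known to lie in \<open>S\<close>.\<close>
    also have "\<dots> = (\<alpha> + \<alpha>) * (const_mero (c1 + c2) + const_mero (c1 * c2) * (Y\<^sup>2 / F)) -
        (const_mero (c2 * (c1 + c2)) * (lam ^ N / F) * \<beta> + const_mero c1 * (lam ^ N * \<beta>)) +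
        (const_mero (c2 * (c1 + c2)) * (lam ^ N / F) * \<gamma> + const_mero c1 * (\<gamma> / lam ^ N))"
    proof -
      have "2 * \<alpha> * (c + d + c * d * y) - \<beta> * (d * (c + d) * x + c * u) + \<gamma> * (d * (c + d) * x + c / u) =
          (\<alpha> + \<alpha>) * ((c + d) + c * d * y) - (d * (c + d) * x * \<beta> + c * (u * \<beta>)) +
          (d * (c + d) * x * \<gamma> + c * (\<gamma> / u))" for c d x y u
        by (simp add: algebra_simps)
      then show ?thesis
        unfolding s_identities(3-5) const_mero_simps .
    qed
    finally have eq: "v * (F / lam ^ N) = \<dots>" .
    show "v * (F / lam ^ N) \<in> S"
      unfolding eq by (intro S_add S_diff S_mult S_const S_lam S \<beta> \<gamma> YF) auto
    show "rotation_invariant (v * (F / lam ^ N))"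
      unfolding rotation_invariant_def v_def
      by (simp add: mero_comp_add mero_comp_diff mero_comp_mult mero_comp_divide mero_comp_numeral
          mero_comp_1 mero_comp_power[where f = "1 + s"] mero_comp_power[where f = "1 - s"]
          mero_comp_power[where f = s] rotation_nonconst rot mero_comp_rotation
          mero_comp_orbit_rotation N_pos)
    show "mero_comp (v * (F / lam ^ N)) (1 / lam) = - (v * (F / lam ^ N))"
    proof -
      have "mero_comp (F / lam ^ N) (1 / lam) = F / lam ^ N"
        by (simp add: mero_comp_divide inverse_lam_nonconst refl' power_even_eq power2_eq_square)
      moreover have "mero_comp v (1 / lam) = - v"
        by (simp add: v_def mero_comp_add mero_comp_diff mero_comp_mult mero_comp_numeral mero_comp_1
            mero_comp_power inverse_lam_nonconst refl refl')
      ultimately show ?thesis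
        by (simp only: mero_comp_mult[OF inverse_lam_nonconst]) simp
    qed
  qed

  have "b * G = v / 4"
    using F_nonzero H_nonzero by (simp add: b_def G_eq)
  moreover have "c * H = w / 4"
    using H_nonzero by (simp add: c_def)
  moreover have "\<alpha> = a * s + v / 4 + w / 4 * (1 - s\<^sup>2)" "\<beta> = a * (1 - s) - v / 4 + w / 4 * (1 - s)\<^sup>2"
      "\<gamma> = a * (1 + s) + v / 4 - w / 4 * (1 + s)\<^sup>2"
    unfolding a_def v_def w_def by (simp_all add: power2_eq_square field_simps)
  ultimately have "f = frame j (a * s + b * G + c * H * (1 - s\<^sup>2))
      (a * (1 - s) - b * G + c * H * (1 - s)\<^sup>2) (a * (1 + s) + b * G - c * H * (1 + s)\<^sup>2)"
    unfolding f frame_eq_iff by metis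
  then show ?thesis
    unfolding combination_frame using \<open>a \<in> R\<close> \<open>b \<in> R\<close> \<open>c \<in> R\<close> by blast
qed

lemma automorphic_lie_algebra_eq_combinations:
  "A = {a *\<^sub>M e_zero N j c1 c2 + b *\<^sub>M e_plus N j c1 c2 + c *\<^sub>M e_minus N j c1 c2 | a b c.
     a \<in> R \<and> b \<in> R \<and> c \<in> R}"
  using combination_if_in_A combination_in_A by blast

end

end

text \<open>Proportional coefficients make F a nonzero multiple of a power of F_k. Used in the
  contrapositive, to obtain independence from \<Gamma>_k \<noteq> \<Gamma>.\<close>

lemma zero_set_form_orbit_eq_exceptional:
  assumes "N > 0" "k \<in> {0, 1, 2}" "(d1, d2) = (if k = 0 then (1, - 1) else if k = 1 then (1, 0) else (0, 1))"
    and "(c1, c2) \<noteq> (0, 0)" "c1 * d2 = c2 * d1"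
  shows "zero_set (form_orbit N c1 c2) = exceptional_orbit N k"
proof -
  have "form_orbit N c1 c2 x y = 0 \<longleftrightarrow> form N k x y = 0" for x y :: complex
  proof -
    have diff: "((x ^ N + y ^ N) / 2)\<^sup>2 - (x * y) ^ N = ((x ^ N - y ^ N) / 2)\<^sup>2"
    proof -
      have "((p + q) / 2)\<^sup>2 - p * q = ((p - q) / 2)\<^sup>2" for p q :: complex
        by (simp add: power2_eq_square field_simps)
      then show ?thesis by (simp add: power_mult_distrib)
    qed
    consider "k = 0" | "k = 1" | "k = 2"
      using assms(2) by blast
    then show ?thesis
    proof cases
      case 1
      with assms have c: "c2 = - c1" "c1 \<noteq> 0" by auto
      have "form_orbit N c1 c2 x y = c1 * (((x ^ N + y ^ N) / 2)\<^sup>2 - (x * y) ^ N)"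
        by (simp add: form_orbit_def form_def c right_diff_distrib)
      also have "\<dots> = c1 * (form N k x y)\<^sup>2"
        unfolding diff by (simp add: form_def 1)
      finally show ?thesis using c(2) by simp
    next
      case 2
      with assms have "c2 = 0" "c1 \<noteq> 0" by auto
      then show ?thesis by (simp add: form_orbit_def 2)
    next
      case 3
      with assms have "c1 = 0" "c2 \<noteq> 0" by auto
      then show ?thesis using assms(1) by (simp add: form_orbit_def 3)
    qed
  qed
  then have "zero_set (form_orbit N c1 c2) = zero_set (form N k)"
    by (simp add: zero_set_def)
  then show ?thesis
    using zero_set_form[OF assms(1)] by simp
qed

theorem theorem4p3:
  fixes N j k :: nat and c1 c2 :: complex and \<Gamma> :: "sphere set"
  assumes "N \<ge> 2"
    and "1 \<le> j" and "2 * j < cover_index N"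
    and "\<Gamma> \<in> orbits (dihedral N) UNIV (sphere_action N)"
    and "(c1, c2) \<noteq> (0, 0)"
    and "\<Gamma> \<subseteq> zero_set (form_orbit N c1 c2)"
    and "k \<in> {0, 1, 2}"
    and "exceptional_orbit N k \<noteq> \<Gamma>"
  defines "e0 \<equiv> e_zero N j c1 c2"
    and "ep \<equiv> e_plus N j c1 c2"
    and "em \<equiv> e_minus N j c1 c2"
    and "F \<equiv> form_orbit_mero N c1 c2"
    and "R \<equiv> adjoin (form_mero N k ^ nu N k / form_orbit_mero N c1 c2)"
  shows "automorphic_lie_algebra N j \<Gamma> =
           {a *\<^sub>M e0 + b *\<^sub>M ep + c *\<^sub>M em | a b c. a \<in> R \<and> b \<in> R \<and> c \<in> R} \<and>
         (\<forall>a \<in> R. \<forall>b \<in> R. \<forall>c \<in> R.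
            a *\<^sub>M e0 + b *\<^sub>M ep + c *\<^sub>M em = 0 \<longrightarrow> a = 0 \<and> b = 0 \<and> c = 0) \<and>
         bracket e0 ep = 2 *\<^sub>M ep \<and>
         bracket e0 em = (- 2) *\<^sub>M em \<and>
         bracket ep em = (\<Prod>i = 0..2. form_mero N i ^ nu N i / F) *\<^sub>M e0"
proof -
  \<comment> \<open>For even N the bound on j is j < N itself; for odd N it is the stronger 2j <
    N.\<close>
  have N: "N > 0" and j: "0 < j" "j < N"
    using assms(1-3) by (auto simp: cover_index_def split: if_splits)
  interpret single_orbit N c1 c2
    by unfold_locales (use N assms(5) in auto)
  have \<Gamma>: "zero_set (form_orbit N c1 c2) = \<Gamma>"
    using zero_set_form_orbit_eq[OF N assms(5,4,6)] .
  define d1 d2 :: complex where "d1 = (if k = 2 then 0 else 1)"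
    and "d2 = (if k = 0 then - 1 else if k = 1 then 0 else 1)"
  have d: "(d1, d2) = (if k = 0 then (1, - 1) else if k = 1 then (1, 0) else (0, 1))"
    using assms(7) by (auto simp: d1_def d2_def)
  have independent: "c1 * d2 \<noteq> c2 * d1"
    using zero_set_form_orbit_eq_exceptional[OF N assms(7) d assms(5)] \<Gamma> assms(8) by auto
  have "form_mero N k ^ nu N k = form_orbit_mero N d1 d2"
    using form_power_eq_form_orbit[OF assms(7) d] .
  then have R: "R = adjoin (form_orbit_mero N d1 d2 / form_orbit_mero N c1 c2)"
    by (simp add: R_def)
  show ?thesis
    unfolding e0_def ep_def em_def F_def
  proof (intro conjI)
    show "automorphic_lie_algebra N j \<Gamma> =
        {a *\<^sub>M e_zero N j c1 c2 + b *\<^sub>M e_plus N j c1 c2 + c *\<^sub>M e_minus N j c1 c2 | a b c.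
          a \<in> R \<and> b \<in> R \<and> c \<in> R}"
      using automorphic_lie_algebra_eq_combinations[OF j independent] unfolding \<Gamma> R .
  qed (use combination_eq_0 in blast, rule bracket_e_zero_e_plus, rule bracket_e_zero_e_minus,
      rule bracket_e_plus_e_minus)
qed

end
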